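(* Let $A=\Bbbk Q/I$ be a locally gentle algebra over a field $\Bbbk$ with a unique maximal path, which is infinite. Then either $A\cong\Bbbk[x]$ or $\operatorname{Aut}_0(A)\subseteq\operatorname{Inn}^*(A)$. Consequently, if $A\not\cong\Bbbk[x]$, then any algebra automorphism of $A$ is a composition of an inner automorphism and a graded automorphism.
   Context: Quivers $Q=(Q_0,Q_1,s,t)$ are finite, connected, with at least one arrow. A path of length $n\ge 1$ is $p=\alpha_1\cdots\alpha_n$ with $\alpha_i\in Q_1$, $t(\alpha_i)=s(\alpha_{i+1})$; for each vertex $v$ there is a stationary path $\epsilon_v$ of length $0$. $\Bbbk Q$ is the path algebra (product = concatenation), graded by path length. $A=\Bbbk Q/I$ is locally gentle if it is infinite-dimensional and: (i) every vertex has in-degree $\le 2$ and out-degree $\le 2$; (ii') whenever $s(\alpha)=t(\beta)=t(\beta')$ with $\beta\ne\beta'$ arrows, exactly one of $\beta\alpha,\beta'\alpha$ is in $I$; (iii') whenever $t(\alpha)=s(\beta)=s(\beta')$ with $\beta\neq\beta'$, exactly one of $\alpha\beta,\alpha\beta'$ is in $I$; (iv') $I$ is generated by paths of length $2$. $\mathcal B$ is the basis of $A$ of paths not in $I$; $A_n$ is the span of paths in $\mathcal B$ of length $n$; $A_+=\bigoplus_{n>0}A_n$. A finite maximal path is a $p\in\mathcal B$ with $\alpha p=0=p\alpha$ in $A$ for all $\alpha\in Q_1$. A nonstationary primitive cycle $c\in\mathcal B$ with $c^n\notin I$ for all $n$ generates an infinite maximal path $c^\infty$, whose subpaths are the paths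 in $\mathcal B$ that are subpaths of some $c^n$; $c^\infty$ and $(c')^\infty$ are regarded as the same if $c$ is a subpath of some power of $c'$. In a locally gentle algebra every arrow lies in a unique maximal path (finite or infinite); having a unique, infinite maximal path means that there is exactly one maximal path in total, it is infinite, and it contains all arrows. $\operatorname{Aut}_0(A)$ is the group of algebra automorphisms $f$ such that the graded map sending $x\in A_n$ to the degree $n$ component of $f(x)$ (for all $n$) is the identity. For a unit $u$, $\Delta_u(z)=u^{-1}zu$, and $\operatorname{Inn}^*(A)=\{\Delta_{1+y}: y\in A_+,\ 1+y\in A^\times\}$. *)

theory Defs
  imports
    "HOL-Library.Poly_Mapping"
    "HOL-Library.Sublist"
    "HOL-Computational_Algebra.Polynomial"
    "Graph_Theory.Digraph_Component"
    "Graph_Theory.Arc_Walk"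
    "HOL-Algebra.Algebra"
begin

section \<open>Algebras over a field\<close>

text \<open>
  A \<open>\<k>\<close>-algebra (unital, associative, not necessarily commutative) is carried by the record
  type \<^typ>\<open>('k, 'a) module\<close>, with \<open>\<k>\<close> the field given by the type \<open>'k\<close>.
  The HOL-Algebra locale for algebras is not used, since it covers commutative algebras only.
\<close>

definition alg_iso :: "('k, 'a, 'm) module_scheme \<Rightarrow> ('k, 'b, 'n) module_scheme \<Rightarrow> ('a \<Rightarrow> 'b) set"
  where "alg_iso A B =
    {h \<in> ring_iso A B. \<forall>c. \<forall>x\<in>carrier A. h (c \<odot>\<^bsub>A\<^esub> x) = c \<odot>\<^bsub>B\<^esub> h x}"

definition alg_isomorphic :: "('k, 'a, 'm) module_scheme \<Rightarrow> ('k, 'b, 'n) module_scheme \<Rightarrow> bool"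
  where "alg_isomorphic A B \<longleftrightarrow> alg_iso A B \<noteq> {}"

text \<open>As for \<^const>\<open>Bij\<close>, automorphisms are extensional functions, so that two automorphisms
  are equal as soon as they agree on the carrier.\<close>

definition alg_auto :: "('k, 'a, 'm) module_scheme \<Rightarrow> ('a \<Rightarrow> 'a) set"
  where "alg_auto A = alg_iso A A \<inter> extensional (carrier A)"

definition conj_auto :: "('a, 'm) ring_scheme \<Rightarrow> 'a \<Rightarrow> 'a \<Rightarrow> 'a"
  where "conj_auto A u = (\<lambda>z\<in>carrier A. inv\<^bsub>A\<^esub> u \<otimes>\<^bsub>A\<^esub> z \<otimes>\<^bsub>A\<^esub> u)"

definition inner_auto :: "('a, 'm) ring_scheme \<Rightarrow> ('a \<Rightarrow> 'a) set"
  where "inner_auto A = conj_auto A ` Units A"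

definition poly_algebra :: "('k::field, 'k poly) module"
  where "poly_algebra = \<lparr>carrier = UNIV, monoid.mult = (*), monoid.one = 1,
    ring.zero = 0, ring.add = (+), module.smult = Polynomial.smult\<rparr>"

text \<open>Dimension over \<open>\<k>\<close> is dimension over the copy \<open>{c \<cdot> 1}\<close> of \<open>\<k>\<close> inside the algebra.\<close>

definition inf_dimensional :: "('k, 'a, 'm) module_scheme \<Rightarrow> bool"
  where "inf_dimensional A \<longleftrightarrow>
    \<not> ring.finite_dimension A (range (\<lambda>c. c \<odot>\<^bsub>A\<^esub> \<one>\<^bsub>A\<^esub>)) (carrier A)"


section \<open>Quivers and path algebras\<close>

text \<open>The source and target maps are \<^const>\<open>tail\<close> and \<^const>\<open>head\<close>; loops and multiple arrows
  are allowed.\<close>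

definition quiver :: "('v, 'a) pre_digraph \<Rightarrow> bool"
  where "quiver Q \<longleftrightarrow> fin_digraph Q \<and> Digraph_Component.connected Q \<and> arcs Q \<noteq> {}"

text \<open>A path is a starting vertex together with the list of its arrows, read in the order of
  composition; \<open>(v, [])\<close> is the stationary path at \<open>v\<close>.\<close>

type_synonym ('v, 'a) path = "'v \<times> 'a list"

definition paths :: "('v, 'a) pre_digraph \<Rightarrow> ('v, 'a) path set"
  where "paths Q = {(u, p). \<exists>v. pre_digraph.awalk Q u p v}"

definition path_target :: "('v, 'a) pre_digraph \<Rightarrow> ('v, 'a) path \<Rightarrow> 'v"
  where "path_target Q p = last (pre_digraph.awalk_verts Q (fst p) (snd p))"

definition path_length :: "('v, 'a) path \<Rightarrow> nat"
  where "path_length p = length (snd p)"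

definition path_power :: "('v, 'a) path \<Rightarrow> nat \<Rightarrow> ('v, 'a) path"
  where "path_power c n = (fst c, concat (replicate n (snd c)))"

text \<open>This describes subpaths \<open>p\<close> of \<open>q\<close> with \<open>p\<close> nonstationary, which is the only case in which
  it is used.\<close>

definition subpath :: "('v, 'a) path \<Rightarrow> ('v, 'a) path \<Rightarrow> bool"
  where "subpath p q \<longleftrightarrow> sublist (snd p) (snd q)"

abbreviation arrow :: "('v, 'a) pre_digraph \<Rightarrow> 'a \<Rightarrow> ('v, 'a) path"
  where "arrow Q \<alpha> \<equiv> (tail Q \<alpha>, [\<alpha>])"

abbreviation arrow2 :: "('v, 'a) pre_digraph \<Rightarrow> 'a \<Rightarrow> 'a \<Rightarrow> ('v, 'a) path"
  where "arrow2 Q \<alpha> \<beta> \<equiv> (tail Q \<alpha>, [\<alpha>, \<beta>])"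

abbreviation path_elt :: "('v, 'a) path \<Rightarrow> ('v, 'a) path \<Rightarrow>\<^sub>0 'k::field"
  where "path_elt p \<equiv> Poly_Mapping.single p 1"

text \<open>The multiplication below is not the convolution product on \<^type>\<open>poly_mapping\<close>: products of
  non-composable paths vanish.\<close>

definition path_algebra ::
    "('v, 'a) pre_digraph \<Rightarrow> ('k::field, ('v, 'a) path \<Rightarrow>\<^sub>0 'k) module"
  where "path_algebra Q =
    \<lparr>carrier = {f. Poly_Mapping.keys f \<subseteq> paths Q},
     monoid.mult = (\<lambda>f g. \<Sum>p\<in>Poly_Mapping.keys f. \<Sum>q\<in>Poly_Mapping.keys g.
       if path_target Q p = fst q
       then Poly_Mapping.single (fst p, snd p @ snd q)
              (Poly_Mapping.lookup f p * Poly_Mapping.lookup g q)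
       else 0),
     monoid.one = (\<Sum>v\<in>verts Q. path_elt (v, [])),
     ring.zero = 0,
     ring.add = (+),
     module.smult = (\<lambda>c f. Poly_Mapping.map ((*) c) f)\<rparr>"

text \<open>\<^const>\<open>FactRing\<close> has no scalar multiplication, so the induced one is added here.\<close>

definition path_quot :: "('v, 'a) pre_digraph \<Rightarrow> (('v, 'a) path \<Rightarrow>\<^sub>0 'k::field) set \<Rightarrow>
    ('k, (('v, 'a) path \<Rightarrow>\<^sub>0 'k) set) module"
  where "path_quot Q I = ring.extend (path_algebra Q Quot I)
    (module.fields
      (\<lambda>c Y. \<Union>x\<in>Y. I +>\<^bsub>path_algebra Q\<^esub> (c \<odot>\<^bsub>path_algebra Q\<^esub> x)))"

abbreviation path_class :: "('v, 'a) pre_digraph \<Rightarrow> (('v, 'a) path \<Rightarrow>\<^sub>0 'k::field) set \<Rightarrow>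
    ('v, 'a) path \<Rightarrow> (('v, 'a) path \<Rightarrow>\<^sub>0 'k) set"
  where "path_class Q I p \<equiv> I +>\<^bsub>path_algebra Q\<^esub> path_elt p"


section \<open>Locally gentle algebras\<close>

definition locally_gentle ::
    "('v, 'a) pre_digraph \<Rightarrow> (('v, 'a) path \<Rightarrow>\<^sub>0 'k::field) set \<Rightarrow> bool"
  where "locally_gentle Q I \<longleftrightarrow>
    quiver Q \<and>
    (\<exists>R \<subseteq> {p \<in> paths Q. path_length p = 2}. I = Idl\<^bsub>path_algebra Q\<^esub> (path_elt ` R)) \<and>
    inf_dimensional (path_quot Q I) \<and>
    (\<forall>v\<in>verts Q. in_degree Q v \<le> 2 \<and> out_degree Q v \<le> 2) \<and>
    (\<forall>\<alpha>\<in>arcs Q. \<forall>\<beta>\<in>arcs Q. \<forall>\<beta>'\<in>arcs Q.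
      tail Q \<alpha> = head Q \<beta> \<and> tail Q \<alpha> = head Q \<beta>' \<and> \<beta> \<noteq> \<beta>' \<longrightarrow>
      (path_elt (arrow2 Q \<beta> \<alpha>) \<in> I) \<noteq> (path_elt (arrow2 Q \<beta>' \<alpha>) \<in> I)) \<and>
    (\<forall>\<alpha>\<in>arcs Q. \<forall>\<beta>\<in>arcs Q. \<forall>\<beta>'\<in>arcs Q.
      head Q \<alpha> = tail Q \<beta> \<and> head Q \<alpha> = tail Q \<beta>' \<and> \<beta> \<noteq> \<beta>' \<longrightarrow>
      (path_elt (arrow2 Q \<alpha> \<beta>) \<in> I) \<noteq> (path_elt (arrow2 Q \<alpha> \<beta>') \<in> I))"

definition basis_paths ::
    "('v, 'a) pre_digraph \<Rightarrow> (('v, 'a) path \<Rightarrow>\<^sub>0 'k::field) set \<Rightarrow> ('v, 'a) path set"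
  where "basis_paths Q I = {p \<in> paths Q. (path_elt p :: _ \<Rightarrow>\<^sub>0 'k) \<notin> I}"

definition finite_maximal_path ::
    "('v, 'a) pre_digraph \<Rightarrow> (('v, 'a) path \<Rightarrow>\<^sub>0 'k::field) set \<Rightarrow> ('v, 'a) path \<Rightarrow> bool"
  where "finite_maximal_path Q I p \<longleftrightarrow> p \<in> basis_paths Q I \<and>
    (\<forall>\<alpha>\<in>arcs Q.
      path_class Q I (arrow Q \<alpha>) \<otimes>\<^bsub>path_quot Q I\<^esub> path_class Q I p = \<zero>\<^bsub>path_quot Q I\<^esub> \<and>
      path_class Q I p \<otimes>\<^bsub>path_quot Q I\<^esub> path_class Q I (arrow Q \<alpha>) = \<zero>\<^bsub>path_quot Q I\<^esub>)"

definition cycle_path :: "('v, 'a) pre_digraph \<Rightarrow> ('v, 'a) path \<Rightarrow> bool"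
  where "cycle_path Q c \<longleftrightarrow> c \<in> paths Q \<and> path_length c > 0 \<and> path_target Q c = fst c"

definition primitive_cycle :: "('v, 'a) pre_digraph \<Rightarrow> ('v, 'a) path \<Rightarrow> bool"
  where "primitive_cycle Q c \<longleftrightarrow> cycle_path Q c \<and>
    \<not> (\<exists>d n. cycle_path Q d \<and> n \<ge> 2 \<and> c = path_power d n)"

definition infinite_path_generator ::
    "('v, 'a) pre_digraph \<Rightarrow> (('v, 'a) path \<Rightarrow>\<^sub>0 'k::field) set \<Rightarrow> ('v, 'a) path \<Rightarrow> bool"
  where "infinite_path_generator Q I c \<longleftrightarrow>
    c \<in> basis_paths Q I \<and> primitive_cycle Q c \<and> (\<forall>n. path_elt (path_power c n) \<notin> I)"

text \<open>Generators \<open>c\<close>, \<open>c'\<close> give the same infinite path if \<open>c\<close> is a subpath of a power of \<open>c'\<close>.\<close>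

definition unique_infinite_maximal_path ::
    "('v, 'a) pre_digraph \<Rightarrow> (('v, 'a) path \<Rightarrow>\<^sub>0 'k::field) set \<Rightarrow> bool"
  where "unique_infinite_maximal_path Q I \<longleftrightarrow>
    \<not> (\<exists>p. finite_maximal_path Q I p) \<and>
    (\<forall>c c'. infinite_path_generator Q I c \<and> infinite_path_generator Q I c' \<longrightarrow>
      (\<exists>n. subpath c (path_power c' n))) \<and>
    (\<exists>c. infinite_path_generator Q I c \<and>
      (\<forall>\<alpha>\<in>arcs Q. arrow Q \<alpha> \<in> basis_paths Q I \<and> (\<exists>n. subpath (arrow Q \<alpha>) (path_power c n))))"


section \<open>The grading and groups of automorphisms\<close>

definition path_span :: "('v, 'a) pre_digraph \<Rightarrow> (('v, 'a) path \<Rightarrow>\<^sub>0 'k::field) set \<Rightarrow>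
    ('v, 'a) path set \<Rightarrow> (('v, 'a) path \<Rightarrow>\<^sub>0 'k) set set"
  where "path_span Q I S = {I +>\<^bsub>path_algebra Q\<^esub> x | x. Poly_Mapping.keys x \<subseteq> S}"

definition degree_part :: "('v, 'a) pre_digraph \<Rightarrow> (('v, 'a) path \<Rightarrow>\<^sub>0 'k::field) set \<Rightarrow>
    nat \<Rightarrow> (('v, 'a) path \<Rightarrow>\<^sub>0 'k) set set"
  where "degree_part Q I n = path_span Q I {p \<in> basis_paths Q I. path_length p = n}"

definition positive_part :: "('v, 'a) pre_digraph \<Rightarrow> (('v, 'a) path \<Rightarrow>\<^sub>0 'k::field) set \<Rightarrow>
    (('v, 'a) path \<Rightarrow>\<^sub>0 'k) set set"
  where "positive_part Q I = path_span Q I {p \<in> basis_paths Q I. path_length p > 0}"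

definition homogeneous_decomposition ::
    "('v, 'a) pre_digraph \<Rightarrow> (('v, 'a) path \<Rightarrow>\<^sub>0 'k::field) set \<Rightarrow>
     (('v, 'a) path \<Rightarrow>\<^sub>0 'k) set \<Rightarrow> (nat \<Rightarrow> (('v, 'a) path \<Rightarrow>\<^sub>0 'k) set) \<Rightarrow> bool"
  where "homogeneous_decomposition Q I z g \<longleftrightarrow>
    (\<forall>n. g n \<in> degree_part Q I n) \<and>
    finite {n. g n \<noteq> \<zero>\<^bsub>path_quot Q I\<^esub>} \<and>
    z = finsum (path_quot Q I) g {n. g n \<noteq> \<zero>\<^bsub>path_quot Q I\<^esub>}"

definition degree_component ::
    "('v, 'a) pre_digraph \<Rightarrow> (('v, 'a) path \<Rightarrow>\<^sub>0 'k::field) set \<Rightarrow>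
     nat \<Rightarrow> (('v, 'a) path \<Rightarrow>\<^sub>0 'k) set \<Rightarrow> (('v, 'a) path \<Rightarrow>\<^sub>0 'k) set"
  where "degree_component Q I n z = (THE g. homogeneous_decomposition Q I z g) n"

definition Aut0 :: "('v, 'a) pre_digraph \<Rightarrow> (('v, 'a) path \<Rightarrow>\<^sub>0 'k::field) set \<Rightarrow>
    ((('v, 'a) path \<Rightarrow>\<^sub>0 'k) set \<Rightarrow> (('v, 'a) path \<Rightarrow>\<^sub>0 'k) set) set"
  where "Aut0 Q I = {f \<in> alg_auto (path_quot Q I).
    \<forall>n. \<forall>x\<in>degree_part Q I n. degree_component Q I n (f x) = x}"

definition Inn_star :: "('v, 'a) pre_digraph \<Rightarrow> (('v, 'a) path \<Rightarrow>\<^sub>0 'k::field) set \<Rightarrow>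
    ((('v, 'a) path \<Rightarrow>\<^sub>0 'k) set \<Rightarrow> (('v, 'a) path \<Rightarrow>\<^sub>0 'k) set) set"
  where "Inn_star Q I = {conj_auto (path_quot Q I) (\<one>\<^bsub>path_quot Q I\<^esub> \<oplus>\<^bsub>path_quot Q I\<^esub> y) | y.
    y \<in> positive_part Q I \<and> \<one>\<^bsub>path_quot Q I\<^esub> \<oplus>\<^bsub>path_quot Q I\<^esub> y \<in> Units (path_quot Q I)}"

definition graded_auto :: "('v, 'a) pre_digraph \<Rightarrow> (('v, 'a) path \<Rightarrow>\<^sub>0 'k::field) set \<Rightarrow>
    ((('v, 'a) path \<Rightarrow>\<^sub>0 'k) set \<Rightarrow> (('v, 'a) path \<Rightarrow>\<^sub>0 'k) set) set"
  where "graded_auto Q I = {f \<in> alg_auto (path_quot Q I).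
    \<forall>n. f ` degree_part Q I n = degree_part Q I n}"

end

theory Submission
  imports
    Defs
    "HOL-Computational_Algebra.Formal_Power_Series"
    "HOL-Computational_Algebra.Polynomial_Factorial"
begin

text \<open>
  Let \<open>m\<close> be the least period of the sequence of arrows of the unique maximal path. Every arrow
  occurs exactly once in a period, and a path is nonzero in \<open>A\<close> exactly if it runs along the
  cycle. Hence nonstationary nonzero paths are given by a starting position modulo \<open>m\<close> and a length,
  and \<open>A\<close> is the path algebra of the oriented cycle with \<open>m\<close> arrows, except that in degree \<open>0\<close>
  the positions belonging to one vertex of the quiver are glued. Reading the coefficient of the path of
  length \<open>l\<close> from position \<open>i\<close> as the entry in row \<open>i\<close> and column \<open>i + l\<close> turns \<open>A\<close>
  into an algebra of periodic upper triangular matrices (\<open>kernel_matrix_of\<close>, \<open>mat_ring_iso\<close>).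
  Its centre contains the polynomials in \<open>z\<close>, the sum of all paths of length \<open>m\<close>.

  If \<open>m = 1\<close> this is \<open>\<k>[x]\<close>. Let \<open>m \<ge> 2\<close>. Then the square of every arrow is \<open>0\<close>, so the
  image of an arrow under an endomorphism has a nilpotent, hence vanishing, degree \<open>0\<close> part, and every
  endomorphism preserves the filtration by path length (\<open>hom_low_zero\<close>). For an automorphism \<open>f\<close> that
  is trivial on the associated graded algebra, \<open>f z = z\<close>, because \<open>f z\<close> is a polynomial in \<open>z\<close>
  that has a compositional inverse and agrees with \<open>z\<close> in lowest degree (\<open>fixes_centre\<close>).

  As in the theorem of Skolem and Noether, one then looks for a matrix \<open>u\<close> with \<open>x u = u f(x)\<close> for all
  \<open>x\<close>. If \<open>p\<^sub>i\<close> is the path of length \<open>i\<close> from position \<open>0\<close>, such a \<open>u\<close> is obtained by taking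
  row \<open>0\<close> of \<open>f(p\<^sub>i)\<close>, shifted by \<open>i\<close>, as row \<open>i\<close> of \<open>u\<close>; its diagonal is constant \<open>1\<close>
  (\<open>intertwiner\<close>). Combining it with the matrix belonging to \<open>f\<^sup>-\<^sup>1\<close> gives \<open>y\<close> with
  \<open>f(x) y = y x\<close>, so that \<open>u y\<close> is central, say \<open>u y = q(z)\<close> with \<open>q(0) = 1\<close>. An irreducible
  factor of \<open>q\<close> generates a prime ideal of the matrix algebra and therefore divides \<open>u\<close> or \<open>y\<close>
  (\<open>prime_zpoly_dvd\<close>); it can be cancelled, and after finitely many cancellations \<open>u y = 1\<close>. Thus
  \<open>f\<close> is conjugation by \<open>u\<close> (\<open>graded_trivial_imp_inner\<close>).

  For an arbitrary automorphism \<open>f\<close>, compatibility with the filtration gives a graded automorphism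
  \<open>\<psi>\<close>, namely the associated graded map, and \<open>f \<circ> \<psi>\<^sup>-\<^sup>1\<close> is trivial on the associated graded
  algebra, hence inner (\<open>inner_times_graded\<close>).
\<close>

(* Below, coeff, monom, degree and irreducible are the notions for the type poly and for type classes. *)
hide_const (open) up_ring.coeff up_ring.monom Polynomials.degree Divisibility.irreducible

section \<open>Upper triangular matrices stored by diagonals\<close>

text \<open>
  The value \<open>entry a i l\<close> is the entry in row \<open>i\<close> and column \<open>i + l\<close> of an upper triangular
  matrix indexed by the natural numbers, so that the diagonal index \<open>l\<close> is the degree. Period and
  finiteness conditions are imposed later by predicates; the ring itself does not depend on them.
\<close>

typedef 'k utmat = "UNIV :: (nat \<Rightarrow> nat \<Rightarrow> 'k) set"
  morphisms entry UTMat ..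

lemma entry_UTMat [simp]: "entry (UTMat f) = f"
  by (simp add: UTMat_inverse)

lemma utmat_eqI: "(\<And>i l. entry a i l = entry b i l) \<Longrightarrow> a = b"
  by (simp add: entry_inject[symmetric] fun_eq_iff)

instantiation utmat :: (comm_ring_1) ring_1
begin

definition "0 = UTMat (\<lambda>i l. 0)"
definition "1 = UTMat (\<lambda>i l. if l = 0 then 1 else 0)"
definition "a + b = UTMat (\<lambda>i l. entry a i l + entry b i l)"
definition "a - b = UTMat (\<lambda>i l. entry a i l - entry b i l)"
definition "- a = UTMat (\<lambda>i l. - entry a i l)"
definition "a * b = UTMat (\<lambda>i l. \<Sum>s=0..l. entry a i s * entry b (i + s) (l - s))"

lemma entry_0 [simp]: "entry 0 i l = 0"
  by (simp add: zero_utmat_def)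

lemma entry_1: "entry 1 i l = (if l = 0 then 1 else 0)"
  by (simp add: one_utmat_def)

lemma entry_add [simp]: "entry (a + b) i l = entry a i l + entry b i l"
  by (simp add: plus_utmat_def)

lemma entry_diff [simp]: "entry (a - b) i l = entry a i l - entry b i l"
  by (simp add: minus_utmat_def)

lemma entry_uminus [simp]: "entry (- a) i l = - entry a i l"
  by (simp add: uminus_utmat_def)

lemma entry_mult: "entry (a * b) i l = (\<Sum>s=0..l. entry a i s * entry b (i + s) (l - s))"
  by (simp add: times_utmat_def)

instance
proof
  fix a b c :: "'a utmat"
  show "a * b * c = a * (b * c)"
  proof (rule utmat_eqI)
    fix i l
    have "(\<Sum>j=0..l. \<Sum>s=0..j. entry a i s * entry b (i + s) (j - s) * entry c (i + j) (l - j))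
        = (\<Sum>j=0..l. \<Sum>s=0..j. entry a i s * entry b (i + s) (j - s) * entry c (i + (s + (j - s))) (l - j))"
      by (intro sum.cong) auto
    also have "\<dots> = (\<Sum>j=0..l. \<Sum>s=0..l - j. entry a i j * entry b (i + j) s * entry c (i + (j + s)) (l - j - s))"
      by (rule fps_mult_assoc_lemma[of "\<lambda>s t u. entry a i s * entry b (i + s) t * entry c (i + (s + t)) u"])
    finally show "entry (a * b * c) i l = entry (a * (b * c)) i l"
      by (simp add: entry_mult sum_distrib_left sum_distrib_right mult.assoc add.assoc)
  qed
  show "(a + b) * c = a * c + b * c" "a * (b + c) = a * b + a * c"
    by (auto intro!: utmat_eqI simp: entry_mult algebra_simps sum.distrib)
  show "1 * a = a"
    by (auto intro!: utmat_eqI simp: entry_mult entry_1 if_distrib if_distribR sum.delta cong: if_cong)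
  show "a * 1 = a"
  proof (rule utmat_eqI)
    fix i l
    have "entry (a * 1) i l = (\<Sum>s=0..l. if s = l then entry a i s else 0)"
      unfolding entry_mult by (intro sum.cong) (auto simp: entry_1)
    then show "entry (a * 1) i l = entry a i l" by simp
  qed
  show "(0::'a utmat) \<noteq> 1"
  proof
    assume "(0::'a utmat) = 1"
    then have "entry (0::'a utmat) 0 0 = entry 1 0 0" by simp
    then show False by (simp add: entry_1)
  qed
qed (auto intro!: utmat_eqI)

end

definition scal :: "'k::comm_ring_1 \<Rightarrow> 'k utmat \<Rightarrow> 'k utmat"
  where "scal c a = UTMat (\<lambda>i l. c * entry a i l)"

lemma entry_scal [simp]: "entry (scal c a) i l = c * entry a i l"
  by (simp add: scal_def)

lemma scal_1 [simp]: "scal 1 a = a"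
  by (rule utmat_eqI) simp

lemma entry_sum: "entry (sum f S) i l = (\<Sum>x\<in>S. entry (f x) i l)"
  by (induction S rule: infinite_finite_induct) auto

definition diag_comp :: "nat \<Rightarrow> 'k::comm_ring_1 utmat \<Rightarrow> 'k utmat"
  where "diag_comp n a = UTMat (\<lambda>i l. if l = n then entry a i l else 0)"

lemma entry_diag_comp [simp]: "entry (diag_comp n a) i l = (if l = n then entry a i l else 0)"
  by (simp add: diag_comp_def)

text \<open>Membership in step \<open>n\<close> of the filtration by degree.\<close>

definition low_zero :: "nat \<Rightarrow> 'k::comm_ring_1 utmat \<Rightarrow> bool"
  where "low_zero n a \<longleftrightarrow> (\<forall>i. \<forall>l<n. entry a i l = 0)"

lemma low_zero_0 [simp]: "low_zero 0 a"
  by (simp add: low_zero_def)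

lemma low_zero_mono: "low_zero n a \<Longrightarrow> k \<le> n \<Longrightarrow> low_zero k a"
  by (auto simp: low_zero_def)

lemma low_zero_sum: "(\<And>x. x \<in> S \<Longrightarrow> low_zero n (f x)) \<Longrightarrow> low_zero n (sum f S)"
  by (auto simp: low_zero_def entry_sum)

lemma low_zero_diag_comp: "low_zero n (diag_comp n a)"
  by (simp add: low_zero_def)

text \<open>Leading diagonals multiply: \<open>s = p\<close> is the only splitting of the degree \<open>p + q\<close> in which
  neither factor lies below its leading diagonal.\<close>

lemma entry_mult_low:
  assumes "low_zero p a" "low_zero q b"
  shows "entry (a * b) i (p + q) = entry a i p * entry b (i + p) q"
proof -
  have "entry (a * b) i (p + q) = (\<Sum>s\<in>{0..p+q}. if s = p then entry a i p * entry b (i + p) q else 0)"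
    unfolding entry_mult
  proof (intro sum.cong refl)
    fix s assume "s \<in> {0..p+q}"
    then show "entry a i s * entry b (i + s) (p + q - s) = (if s = p then entry a i p * entry b (i + p) q else 0)"
      using assms by (cases s p rule: linorder_cases) (auto simp: low_zero_def)
  qed
  then show ?thesis by simp
qed

lemma entry_mult_0: "entry (a * b) i 0 = entry a i 0 * entry b i 0"
  by (simp add: entry_mult)

lemma low_zero_mult:
  assumes "low_zero p a" "low_zero q b"
  shows "low_zero (p + q) (a * b)"
  unfolding low_zero_def
proof (intro allI impI)
  fix i l assume l: "l < p + q"
  show "entry (a * b) i l = 0"
    unfolding entry_mult
  proof (intro sum.neutral ballI)
    fix s assume s: "s \<in> {0..l}"
    have "s < p \<or> l - s < q" using l s by auto
    then show "entry a i s * entry b (i + s) (l - s) = 0"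
      using assms by (auto simp: low_zero_def)
  qed
qed

text \<open>The diagonals of \<open>a\<close> vanish one after the other, since diagonal \<open>l\<close> of \<open>u * a\<close> is diagonal
  \<open>l\<close> of \<open>a\<close> plus terms that contain only lower diagonals of \<open>a\<close>.\<close>

lemma unipotent_cancel_left:
  fixes u :: "'k::field utmat"
  assumes "u * a = 0" and "\<And>i. entry u i 0 = 1"
  shows "a = 0"
proof -
  have "entry a i l = 0" for i l
  proof (induction l arbitrary: i rule: less_induct)
    case (less l)
    have "0 = entry (u * a) i l" using assms by simp
    also have "\<dots> = (\<Sum>s\<in>{0..l}. if s = 0 then entry a i l else 0)"
      unfolding entry_mult using less assms(2) by (intro sum.cong) auto
    also have "\<dots> = entry a i l" by simp
    finally show ?case by simp
  qed
  then show ?thesis by (intro utmat_eqI) simp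
qed

section \<open>The path algebra of a cycle with glued vertices\<close>

text \<open>Positions on the cycle are natural numbers modulo \<open>m\<close>, and \<open>\<tau> i\<close> is the vertex at which the
  arrow at position \<open>i\<close> starts.\<close>

locale glued_cycle =
  fixes m :: nat and \<tau> :: "nat \<Rightarrow> 'v"
  assumes m_pos: "0 < m" and \<tau>_periodic: "\<tau> (i + m) = \<tau> i"
begin

text \<open>The degree bound makes a periodic matrix a finite linear combination of paths.\<close>

definition periodic :: "'k::field utmat \<Rightarrow> bool"
  where "periodic a \<longleftrightarrow>
    (\<forall>i l. entry a (i + m) l = entry a i l) \<and> (\<exists>N. \<forall>i. \<forall>l>N. entry a i l = 0)"

text \<open>Periodic matrices form the path algebra of the oriented \<open>m\<close>-cycle, a hereditary order over
  \<open>\<k>[z]\<close>. Stationary paths live on diagonal \<open>0\<close>, so identifying positions of the same vertex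
  is a condition on that diagonal only.\<close>

definition glued_order :: "'k::field utmat set"
  where "glued_order = {a. periodic a \<and> (\<forall>i j. \<tau> i = \<tau> j \<longrightarrow> entry a i 0 = entry a j 0)}"

text \<open>The matrix of the path of length \<open>n\<close> that starts at position \<open>i\<close>. For \<open>n = 0\<close> it is a
  primitive idempotent of the cycle, which gluing may exclude.\<close>

definition pathmat :: "nat \<Rightarrow> nat \<Rightarrow> 'k::field utmat"
  where "pathmat i n = UTMat (\<lambda>j l. if l = n \<and> j mod m = i mod m then 1 else 0)"

lemma entry_pathmat: "entry (pathmat i n) j l = (if l = n \<and> j mod m = i mod m then 1 else 0)"
  by (simp add: pathmat_def)

lemma periodic_shift: "periodic a \<Longrightarrow> entry a (i + m) l = entry a i l"
  by (simp add: periodic_def)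

lemma periodic_shift': "periodic a \<Longrightarrow> entry a (i + k * m) l = entry a i l"
proof (induction k)
  case (Suc k)
  have "entry a (i + Suc k * m) l = entry a ((i + k * m) + m) l" by (simp add: algebra_simps)
  then show ?case using Suc by (simp only: periodic_shift)
qed simp

lemma periodic_mod: "periodic a \<Longrightarrow> entry a (i mod m) l = entry a i l"
  using periodic_shift'[of a "i mod m" "i div m" l] by (simp add: mod_div_mult_eq)

lemma periodic_cong: "periodic a \<Longrightarrow> i mod m = j mod m \<Longrightarrow> entry a i l = entry a j l"
  using periodic_mod[of a i l] periodic_mod[of a j l] by simp

lemma periodic_0 [simp]: "periodic 0" by (simp add: periodic_def)

lemma periodic_1 [simp]: "periodic 1"
  by (auto simp: periodic_def entry_1 intro!: exI[of _ 0])

lemma periodic_uminus [simp]: "periodic a \<Longrightarrow> periodic (- a)"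
  by (auto simp: periodic_def)

lemma periodic_scal [simp]: "periodic a \<Longrightarrow> periodic (scal c a)"
  unfolding periodic_def by (metis entry_scal mult_zero_right)

lemma periodic_add [simp]: "periodic a \<Longrightarrow> periodic b \<Longrightarrow> periodic (a + b)"
proof -
  assume a: "periodic a" and b: "periodic b"
  from a b obtain N M where "\<forall>i. \<forall>l>N. entry a i l = 0" "\<forall>i. \<forall>l>M. entry b i l = 0"
    by (auto simp: periodic_def)
  then have "\<forall>i. \<forall>l>max N M. entry (a + b) i l = 0" by auto
  moreover have "entry (a + b) (i + m) l = entry (a + b) i l" for i l
    using a b by (simp add: periodic_def)
  ultimately show ?thesis unfolding periodic_def by blast
qed

lemma periodic_diff [simp]: "periodic a \<Longrightarrow> periodic b \<Longrightarrow> periodic (a - b)"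
  using periodic_add[of a "- b"] by simp

lemma periodic_mult [simp]:
  assumes a: "periodic a" and b: "periodic b" shows "periodic (a * b)"
proof -
  from a b obtain N M where N: "\<forall>i. \<forall>l>N. entry a i l = 0" and M: "\<forall>i. \<forall>l>M. entry b i l = 0"
    by (auto simp: periodic_def)
  have "entry (a * b) i l = 0" if "l > N + M" for i l
    unfolding entry_mult
  proof (intro sum.neutral ballI)
    fix s
    have "s > N \<or> l - s > M" using that by auto
    then show "entry a i s * entry b (i + s) (l - s) = 0"
      using N M by auto
  qed
  moreover have "entry (a * b) (i + m) l = entry (a * b) i l" for i l
  proof -
    have "entry b (i + m + s) k = entry b (i + s) k" for s k
      using periodic_shift[OF b, of "i + s" k] by (simp add: add_ac)
    then show ?thesis by (simp add: entry_mult periodic_shift[OF a])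
  qed
  ultimately show ?thesis unfolding periodic_def by blast
qed

lemma periodic_pathmat [simp]: "periodic (pathmat i n)"
  by (auto simp: periodic_def entry_pathmat intro!: exI[of _ n])

lemma order_periodic: "a \<in> glued_order \<Longrightarrow> periodic a" by (simp add: glued_order_def)

lemma order_glue: "a \<in> glued_order \<Longrightarrow> \<tau> i = \<tau> j \<Longrightarrow> entry a i 0 = entry a j 0"
  unfolding glued_order_def by blast

lemma order_const: "periodic a \<Longrightarrow> (\<And>i. entry a i 0 = c) \<Longrightarrow> a \<in> glued_order"
  by (simp add: glued_order_def)

lemma mem_order_iff:
  "a \<in> glued_order \<longleftrightarrow> periodic a \<and> (\<forall>i j. \<tau> i = \<tau> j \<longrightarrow> entry a i 0 = entry a j 0)"
  by (simp add: glued_order_def)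

lemma order_0 [simp]: "0 \<in> glued_order" by (simp add: glued_order_def)
lemma order_1 [simp]: "1 \<in> glued_order" by (simp add: glued_order_def entry_1)
lemma order_uminus [simp]: "a \<in> glued_order \<Longrightarrow> - a \<in> glued_order"
  unfolding mem_order_iff by (metis entry_uminus periodic_uminus)
lemma order_scal [simp]: "a \<in> glued_order \<Longrightarrow> scal c a \<in> glued_order"
  unfolding mem_order_iff by (metis entry_scal periodic_scal)
lemma order_add [simp]: "a \<in> glued_order \<Longrightarrow> b \<in> glued_order \<Longrightarrow> a + b \<in> glued_order"
  unfolding mem_order_iff by (metis entry_add periodic_add)
lemma order_diff [simp]: "a \<in> glued_order \<Longrightarrow> b \<in> glued_order \<Longrightarrow> a - b \<in> glued_order"
  unfolding mem_order_iff by (metis entry_diff periodic_diff)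
lemma order_mult [simp]: "a \<in> glued_order \<Longrightarrow> b \<in> glued_order \<Longrightarrow> a * b \<in> glued_order"
  unfolding mem_order_iff by (metis entry_mult_0 periodic_mult)
lemma order_sum: "(\<And>x. x \<in> S \<Longrightarrow> f x \<in> glued_order) \<Longrightarrow> sum f S \<in> glued_order"
  by (induction S rule: infinite_finite_induct) auto
lemma order_pathmat [simp]: "0 < n \<Longrightarrow> pathmat i n \<in> glued_order"
  by (rule order_const[of _ 0]) (auto simp: entry_pathmat)

lemma order_diag_comp [simp]:
  assumes "a \<in> glued_order" shows "diag_comp n a \<in> glued_order"
proof -
  have "periodic a" using assms by (simp add: glued_order_def)
  then have "periodic (diag_comp n a)"
    by (auto simp: periodic_def)
  then show ?thesis using assms unfolding mem_order_iff entry_diag_comp by metis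
qed

lemma entry_pathmat_mult:
  assumes "periodic b"
  shows "entry (pathmat i n * b) j l
    = (if j mod m = i mod m \<and> n \<le> l then entry b (i + n) (l - n) else 0)"
proof -
  have "entry (pathmat i n * b) j l
      = (\<Sum>s=0..l. if s = n then (if j mod m = i mod m then entry b (i + n) (l - n) else 0) else 0)"
    unfolding entry_mult
  proof (intro sum.cong refl)
    fix s
    have "j mod m = i mod m \<Longrightarrow> (j + n) mod m = (i + n) mod m" by (metis mod_add_left_eq)
    then show "entry (pathmat i n) j s * entry b (j + s) (l - s)
      = (if s = n then (if j mod m = i mod m then entry b (i + n) (l - n) else 0) else 0)"
      using periodic_cong[OF assms, of "j + n" "i + n" "l - n"] by (auto simp: entry_pathmat)
  qed
  then show ?thesis by simp
qed

lemma entry_mult_pathmat: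
  "entry (b * pathmat i n) j l
    = (if n \<le> l \<and> (j + (l - n)) mod m = i mod m then entry b j (l - n) else 0)"
proof -
  have "entry (b * pathmat i n) j l
      = (\<Sum>s=0..l. if s = l - n then (if n \<le> l \<and> (j + (l - n)) mod m = i mod m then entry b j (l - n) else 0) else 0)"
    unfolding entry_mult by (intro sum.cong) (auto simp: entry_pathmat)
  then show ?thesis by simp
qed

text \<open>The arrow at position \<open>i\<close> ends at position \<open>i + 1\<close>, which differs from \<open>i\<close> modulo \<open>m\<close>; this
  holds even if the arrow is a loop of the quiver.\<close>

lemma arrow_square: "2 \<le> m \<Longrightarrow> pathmat i 1 * pathmat i 1 = (0 :: 'k::field utmat)"
proof (rule utmat_eqI)
  fix j l assume "2 \<le> m"
  have "Suc i mod m \<noteq> i mod m"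
  proof
    assume "Suc i mod m = i mod m"
    then have "m dvd Suc i - i" by (metis le_SucI le_refl mod_eq_dvd_iff_nat)
    with \<open>2 \<le> m\<close> show False by auto
  qed
  then show "entry (pathmat i 1 * pathmat i 1) j l = entry (0 :: 'k utmat) j l"
    by (auto simp: entry_pathmat_mult entry_pathmat)
qed

text \<open>If row \<open>i\<close> of \<open>a\<close> starts with the arrow at position \<open>i\<close>, what remains after splitting off this
  arrow is needed in row \<open>i + 1\<close> only. It is copied to all rows, so that the result has constant
  diagonals and respects every gluing.\<close>

definition const_rows :: "nat \<Rightarrow> 'k::field utmat \<Rightarrow> 'k utmat"
  where "const_rows i a = UTMat (\<lambda>j l. entry a i (Suc l))"

lemma const_rows_order: "periodic a \<Longrightarrow> const_rows i a \<in> glued_order"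
  unfolding periodic_def
proof (rule order_const[of _ "entry a i 1"])
  assume *: "(\<forall>i l. entry a (i + m) l = entry a i l) \<and> (\<exists>N. \<forall>i. \<forall>l>N. entry a i l = 0)"
  then obtain N where "\<forall>i. \<forall>l>N. entry a i l = 0" by auto
  then show "periodic (const_rows i a)"
    unfolding periodic_def const_rows_def by (auto intro!: exI[of _ N])
qed (auto simp: const_rows_def)

text \<open>The arrows generate the part of positive degree as a right ideal, which reduces questions about the
  filtration to arrows.\<close>

lemma arrow_expansion:
  assumes "periodic a" "low_zero 1 a"
  shows "a = (\<Sum>i<m. pathmat i 1 * const_rows i a)"
proof (rule utmat_eqI)
  fix j l
  have "entry (\<Sum>i<m. pathmat i 1 * const_rows i a) j l
      = (\<Sum>i<m. if i = j mod m then (if 1 \<le> l then entry a i l else 0) else 0)"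
    unfolding entry_sum
    using order_periodic[OF const_rows_order[OF assms(1)]]
    by (intro sum.cong) (auto simp: entry_pathmat_mult const_rows_def)
  also have "\<dots> = (if 1 \<le> l then entry a (j mod m) l else 0)"
    using m_pos by simp
  also have "\<dots> = entry a j l"
    using assms by (cases l) (auto simp: periodic_mod low_zero_def)
  finally show "entry a j l = entry (\<Sum>i<m. pathmat i 1 * const_rows i a) j l" by simp
qed

section \<open>Central polynomials\<close>

text \<open>The value of \<open>q\<close> at \<open>z = zpoly [:0, 1:]\<close>, the sum of the paths of length \<open>m\<close> over all
  positions.\<close>

definition zpoly :: "'k::field poly \<Rightarrow> 'k utmat"
  where "zpoly q = UTMat (\<lambda>i l. if m dvd l then coeff q (l div m) else 0)"

lemma entry_zpoly: "entry (zpoly q) i l = (if m dvd l then coeff q (l div m) else 0)"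
  by (simp add: zpoly_def)

lemma sum_multiples:
  "(\<Sum>s=0..l. if m dvd s then f (s div m) else 0) = (\<Sum>k\<le>l div m. f k)"
  for f :: "nat \<Rightarrow> 'b::comm_monoid_add"
proof -
  have "(\<Sum>k\<le>l div m. f k) = (\<Sum>s\<in>(\<lambda>k. m * k) ` {..l div m}. f (s div m))"
    using m_pos by (subst sum.reindex) (auto simp: inj_on_def)
  also have "\<dots> = (\<Sum>s=0..l. if m dvd s then f (s div m) else 0)"
  proof -
    have "(\<lambda>k. m * k) ` {..l div m} = {s\<in>{0..l}. m dvd s}"
    proof (intro equalityI subsetI)
      fix s assume "s \<in> (\<lambda>k. m * k) ` {..l div m}"
      then show "s \<in> {s \<in> {0..l}. m dvd s}"
        using m_pos by (auto simp: less_eq_div_iff_mult_less_eq mult.commute)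
    next
      fix s assume "s \<in> {s \<in> {0..l}. m dvd s}"
      then show "s \<in> (\<lambda>k. m * k) ` {..l div m}"
        by (auto intro!: image_eqI[of _ _ "s div m"] div_le_mono)
    qed
    then show ?thesis using sum.inter_filter[of "{0..l}" "\<lambda>s. f (s div m)" "\<lambda>s. m dvd s"] by simp
  qed
  finally show ?thesis by simp
qed

lemma entry_zpoly_mult:
  assumes "periodic a"
  shows "entry (zpoly q * a) i l = (\<Sum>k\<le>l div m. coeff q k * entry a i (l - m * k))"
proof -
  have "entry (zpoly q * a) i l
      = (\<Sum>s=0..l. if m dvd s then coeff q (s div m) * entry a i (l - m * (s div m)) else 0)"
    unfolding entry_mult
  proof (intro sum.cong refl)
    fix s
    have "entry a (i + s) (l - s) = entry a i (l - s)" if "m dvd s"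
      using that by (intro periodic_cong[OF assms]) auto
    then show "entry (zpoly q) i s * entry a (i + s) (l - s)
      = (if m dvd s then coeff q (s div m) * entry a i (l - m * (s div m)) else 0)"
      by (auto simp: entry_zpoly)
  qed
  then show ?thesis by (simp add: sum_multiples[of "\<lambda>k. coeff q k * entry a i (l - m * k)"])
qed

lemma zpoly_central:
  assumes "periodic a" shows "a * zpoly q = zpoly q * a"
proof (rule utmat_eqI)
  fix i l
  have "entry (a * zpoly q) i l = (\<Sum>s=0..l. entry a i (l - s) * entry (zpoly q) (i + (l - s)) s)"
    unfolding entry_mult by (subst sum.atLeastAtMost_rev) (auto intro!: sum.cong)
  also have "\<dots> = (\<Sum>s=0..l. if m dvd s then coeff q (s div m) * entry a i (l - m * (s div m)) else 0)"
    by (intro sum.cong) (auto simp: entry_zpoly)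
  also have "\<dots> = entry (zpoly q * a) i l"
    by (simp add: entry_zpoly_mult[OF assms] sum_multiples[of "\<lambda>k. coeff q k * entry a i (l - m * k)"])
  finally show "entry (a * zpoly q) i l = entry (zpoly q * a) i l" .
qed

lemma zpoly_order [simp]: "zpoly q \<in> glued_order"
proof (rule order_const[of _ "coeff q 0"])
  have "entry (zpoly q) i l = 0" if "l > m * degree q" for i l
    using that m_pos by (auto simp: entry_zpoly intro!: coeff_eq_0)
  moreover have "entry (zpoly q) (i + m) l = entry (zpoly q) i l" for i l
    by (simp add: entry_zpoly)
  ultimately show "periodic (zpoly q)" unfolding periodic_def by blast
qed (simp add: entry_zpoly)

lemma zpoly_periodic [simp]: "periodic (zpoly q)"
  by (rule order_periodic) simp

lemma zpoly_add: "zpoly (p + q) = zpoly p + zpoly q"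
  by (rule utmat_eqI) (simp add: entry_zpoly)

lemma zpoly_const: "zpoly [:c:] = scal c 1"
proof (rule utmat_eqI)
  fix i l
  show "entry (zpoly [:c:]) i l = entry (scal c 1) i l"
  proof (cases "m dvd l")
    case True
    then obtain k where "l = m * k" ..
    then show ?thesis using m_pos by (cases k) (simp_all add: entry_zpoly entry_1)
  next
    case False
    then have "l \<noteq> 0" by (metis dvd_0_right)
    with False show ?thesis by (simp add: entry_zpoly entry_1)
  qed
qed

lemma zpoly_0 [simp]: "zpoly 0 = 0"
  by (rule utmat_eqI) (simp add: entry_zpoly)

lemma zpoly_1 [simp]: "zpoly 1 = 1"
  using zpoly_const[of 1] by (simp add: one_pCons scal_1)

lemma zpoly_mult: "zpoly (p * q) = zpoly p * zpoly q"
proof (rule utmat_eqI)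
  fix i l
  have d: "m dvd l - m * k \<longleftrightarrow> m dvd l" "(l - m * k) div m = l div m - k" if "k \<le> l div m" for k
  proof -
    have "m * k \<le> l" using that m_pos by (simp add: less_eq_div_iff_mult_less_eq mult.commute)
    then obtain r where r: "l = m * k + r" using le_Suc_ex by blast
    show "m dvd l - m * k \<longleftrightarrow> m dvd l" "(l - m * k) div m = l div m - k"
      using m_pos by (auto simp: r dvd_add_right_iff)
  qed
  have "entry (zpoly p * zpoly q) i l
    = (\<Sum>k\<le>l div m. if m dvd l then coeff p k * coeff q (l div m - k) else 0)"
    unfolding entry_zpoly_mult[OF zpoly_periodic]
    by (intro sum.cong refl) (simp add: d entry_zpoly)
  then show "entry (zpoly (p * q)) i l = entry (zpoly p * zpoly q) i l"
    by (simp add: entry_zpoly coeff_mult)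
qed

lemma zpoly_inj: "zpoly p = zpoly q \<Longrightarrow> p = q"
proof (rule poly_eqI)
  fix k assume "zpoly p = zpoly q"
  then have "entry (zpoly p) 0 (m * k) = entry (zpoly q) 0 (m * k)" by simp
  then show "coeff p k = coeff q k" using m_pos by (simp add: entry_zpoly)
qed

text \<open>The lowest nonzero coefficient of \<open>p\<close> makes the diagonals of \<open>a - b\<close> vanish in increasing
  order.\<close>

lemma zpoly_cancel:
  assumes "zpoly p * a = zpoly p * b" "p \<noteq> 0" "periodic a" "periodic b"
  shows "a = b"
proof -
  have *: "zpoly p * (a - b) = 0" using assms(1) by (simp add: algebra_simps)
  define c where "c = a - b"
  have c: "periodic c" using assms by (simp add: c_def)
  have "\<exists>k. coeff p k \<noteq> 0" using \<open>p \<noteq> 0\<close> leading_coeff_neq_0 by blast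
  then obtain k where k: "coeff p k \<noteq> 0" and k': "\<And>j. j < k \<Longrightarrow> coeff p j = 0"
    using exists_least_iff[of "\<lambda>k. coeff p k \<noteq> 0"] by auto
  have "entry c i l = 0" for i l
  proof (induction l rule: less_induct)
    case (less l)
    have le: "k \<le> (l + m * k) div m" using m_pos by simp
    have "0 = entry (zpoly p * c) i (l + m * k)" using * by (simp add: c_def)
    also have "\<dots> = (\<Sum>j\<le>(l + m * k) div m. if j = k then coeff p k * entry c i l else 0)"
      unfolding entry_zpoly_mult[OF c]
    proof (intro sum.cong refl)
      fix j assume j: "j \<in> {..(l + m * k) div m}"
      show "coeff p j * entry c i (l + m * k - m * j) = (if j = k then coeff p k * entry c i l else 0)"
      proof (cases j k rule: linorder_cases)
        case greater
        have "m * k + m \<le> m * j" using greater by (metis Suc_leI add.commute mult_Suc_right mult_le_mono2)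
        moreover have "m * j \<le> l + m * k"
          using j m_pos less_eq_div_iff_mult_less_eq[of m j "l + m * k"] by (metis atMost_iff mult.commute)
        ultimately have "l + m * k - m * j < l" using m_pos by linarith
        then show ?thesis using less greater by simp
      qed (simp_all add: k')
    qed
    also have "\<dots> = coeff p k * entry c i l" using le by simp
    finally show ?case using k by simp
  qed
  then have "c = 0" by (intro utmat_eqI) simp
  then show ?thesis by (simp add: c_def)
qed

text \<open>Comparing \<open>pathmat i 1 * a\<close> with \<open>a * pathmat i 1\<close> in row \<open>i\<close> expresses row \<open>i + 1\<close> of \<open>a\<close>
  by row \<open>i\<close>: entries in degrees divisible by \<open>m\<close> are copied, all others are \<open>0\<close>. By periodicity
  this determines row \<open>0\<close> too.\<close>

lemma central_imp_zpoly:
  fixes a :: "'k::field utmat"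
  assumes a: "periodic a" and comm: "\<And>i. pathmat i 1 * a = a * pathmat i 1"
  shows "\<exists>q. a = zpoly q"
proof -
  have step: "entry a (i + 1) s = (if m dvd s then entry a i s else 0)" for i s
  proof -
    have "entry (pathmat i 1 * a) i (s + 1) = entry (a * pathmat i 1) i (s + 1)" by (simp only: comm)
    moreover have "(i + s) mod m = i mod m \<longleftrightarrow> m dvd s"
      using mod_eq_dvd_iff_nat[of i "i + s" m] by simp
    ultimately show ?thesis by (simp only: entry_pathmat_mult[OF a] entry_mult_pathmat) simp
  qed
  have dvd: "entry a i s = entry a 0 s" if "m dvd s" for i s
  proof (induction i)
    case (Suc i)
    then show ?case using step[of i s] that by simp
  qed simp
  have ndvd: "entry a i s = 0" if "\<not> m dvd s" for i s
  proof -
    have "entry a i s = entry a (i + (m - 1) + 1) s" using m_pos periodic_shift[OF a, of i s] by simp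
    then show ?thesis by (simp only: step that if_False)
  qed
  obtain N where N: "\<forall>i. \<forall>l>N. entry a i l = 0" using a by (auto simp: periodic_def)
  have co: "coeff (Abs_poly (\<lambda>k. entry a 0 (m * k))) k = entry a 0 (m * k)" for k
  proof -
    have "entry a 0 (m * k) = 0" if "k > N" for k
    proof -
      have "N < m * k" using that m_pos by (metis Suc_leI less_le_trans mult_le_mono1 nat_mult_1 One_nat_def)
      then show ?thesis using N by simp
    qed
    then show ?thesis by (simp add: coeff_Abs_poly[of N])
  qed
  have "a = zpoly (Abs_poly (\<lambda>k. entry a 0 (m * k)))"
  proof (rule utmat_eqI)
    fix i l
    show "entry a i l = entry (zpoly (Abs_poly (\<lambda>k. entry a 0 (m * k)))) i l"
      using dvd[of l i] ndvd[of l i] by (simp add: entry_zpoly co)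
  qed
  then show ?thesis by blast
qed

section \<open>Divisibility by central polynomials\<close>

text \<open>Row \<open>i\<close> restricted to degrees congruent to \<open>r\<close>. For \<open>r < m\<close> these are, up to powers of the
  variable, the entries of \<open>a\<close> as an \<open>m \<times> m\<close> matrix over \<open>\<k>[z]\<close>.\<close>

definition entry_poly :: "'k::field utmat \<Rightarrow> nat \<Rightarrow> nat \<Rightarrow> 'k poly"
  where "entry_poly a i r = Abs_poly (\<lambda>k. entry a i (r + m * k))"

lemma coeff_entry_poly:
  assumes "periodic a" shows "coeff (entry_poly a i r) k = entry a i (r + m * k)"
proof -
  obtain N where N: "\<forall>i. \<forall>l>N. entry a i l = 0" using assms by (auto simp: periodic_def)
  have "entry a i (r + m * k) = 0" if "k > N" for k
  proof -
    have "k \<le> m * k" using m_pos by simp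
    then have "N < r + m * k" using that by linarith
    then show ?thesis using N by simp
  qed
  then show ?thesis unfolding entry_poly_def by (subst coeff_Abs_poly[of N]) auto
qed

text \<open>The quotient is formed entrywise; its degree is bounded since dividing an entry by \<open>p\<close> does not
  raise the degree.\<close>

lemma zpoly_dvdI:
  assumes a: "periodic a" and dvd: "\<And>i r. r < m \<Longrightarrow> p dvd entry_poly a i r" and "p \<noteq> 0"
  shows "\<exists>b. periodic b \<and> a = zpoly p * b"
proof -
  define b where "b = UTMat (\<lambda>i l. coeff (entry_poly a i (l mod m) div p) (l div m))"
  have b_entry: "entry b i l = coeff (entry_poly a i (l mod m) div p) (l div m)" for i l
    by (simp add: b_def)
  obtain N where N: "\<forall>i. \<forall>l>N. entry a i l = 0" using a by (auto simp: periodic_def)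
  have deg: "degree (entry_poly a i r div p) \<le> N" if r: "r < m" for i r
  proof -
    have "degree (entry_poly a i r) \<le> N"
    proof (rule degree_le, intro allI impI)
      fix k assume "N < k"
      moreover have "k \<le> m * k" using m_pos by simp
      ultimately have "N < r + m * k" by linarith
      then show "coeff (entry_poly a i r) k = 0" using N by (simp add: coeff_entry_poly[OF a])
    qed
    moreover have "degree (entry_poly a i r div p) \<le> degree (p * (entry_poly a i r div p))"
      using \<open>p \<noteq> 0\<close> by (cases "entry_poly a i r div p = 0") (auto simp: degree_mult_eq)
    ultimately show ?thesis using dvd[OF r, of i] by simp
  qed
  have "entry b i l = 0" if "l > m * N + m" for i l
  proof -
    have "N < l div m"
    proof (rule ccontr)
      assume "\<not> N < l div m"
      then have "l div m \<le> N" by simp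
      then have "m * (l div m) \<le> m * N" by simp
      moreover have "m * (l div m) + l mod m = l" by simp
      moreover have "l mod m < m" using m_pos by simp
      ultimately show False using that by linarith
    qed
    then show ?thesis unfolding b_entry using deg[of "l mod m" i] m_pos by (intro coeff_eq_0) (use mod_less_divisor in fastforce)
  qed
  moreover have "entry b (i + m) l = entry b i l" for i l
    by (simp add: b_entry entry_poly_def periodic_shift[OF a])
  ultimately have b: "periodic b" unfolding periodic_def by blast
  have "a = zpoly p * b"
  proof (rule utmat_eqI)
    fix i l
    have "entry (zpoly p * b) i l
        = (\<Sum>k\<le>l div m. coeff p k * coeff (entry_poly a i (l mod m) div p) (l div m - k))"
      unfolding entry_zpoly_mult[OF b]
    proof (intro sum.cong refl)
      fix k assume "k \<in> {..l div m}"
      then have "m * k \<le> l" using less_eq_div_iff_mult_less_eq[OF m_pos, of k l] by (simp add: mult.commute)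
      then obtain r where r: "l = m * k + r" using le_Suc_ex by blast
      show "coeff p k * entry b i (l - m * k)
        = coeff p k * coeff (entry_poly a i (l mod m) div p) (l div m - k)"
        using m_pos by (simp add: b_entry r)
    qed
    also have "\<dots> = coeff (p * (entry_poly a i (l mod m) div p)) (l div m)"
      by (simp add: coeff_mult)
    also have "\<dots> = entry a i l"
      using dvd[of "l mod m" i] m_pos by (simp add: coeff_entry_poly[OF a])
    finally show "entry a i l = entry (zpoly p * b) i l" by simp
  qed
  with b show ?thesis by blast
qed

lemma entry_poly_zpoly_mult:
  assumes a: "periodic a" and r: "r < m"
  shows "entry_poly (zpoly p * a) i r = p * entry_poly a i r"
proof (rule poly_eqI)
  fix k
  have "entry (zpoly p * a) i (r + m * k) = (\<Sum>j\<le>k. coeff p j * entry a i (r + m * (k - j)))"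
    unfolding entry_zpoly_mult[OF a] using r m_pos
    by (intro sum.cong) (auto simp: diff_mult_distrib2)
  then show "coeff (entry_poly (zpoly p * a) i r) k = coeff (p * entry_poly a i r) k"
    using a by (simp add: coeff_entry_poly coeff_mult)
qed

text \<open>A path from position \<open>i + r\<close> to position \<open>i'\<close> acts like a matrix unit: between \<open>u\<close> and \<open>y\<close>
  it selects one entry polynomial of each. The monomial accounts for \<open>r + s + r'\<close> exceeding \<open>m\<close>.\<close>

lemma entry_poly_sandwich:
  assumes u: "periodic u" and y: "periodic y" and r: "r < m" and r': "r' < m"
    and js: "(i + r + s) mod m = i' mod m"
  shows "entry_poly (u * (pathmat (i + r) s * y)) i ((r + s + r') mod m)
    = monom 1 ((r + s + r') div m) * (entry_poly u i r * entry_poly y i' r')"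
proof (rule poly_eqI)
  fix k
  define c d where "c = r + s + r'" and "d = c div m"
  define l where "l = c mod m + m * k"
  define T where "T t = entry u i t * entry (pathmat (i + r) s * y) (i + t) (l - t)" for t
  have per: "periodic (u * (pathmat (i + r) s * y))" using u y by simp
  have cd: "c = c mod m + m * d" by (simp add: d_def)
  \<comment> \<open>Only degrees \<open>t\<close> congruent to \<open>r\<close> reach the start of the path, and only if the rest, of degree
    at least \<open>r'\<close>, fits in.\<close>
  have T0: "T t = 0" if "t \<le> l" "\<not> (\<exists>e. l = c + m * e \<and> (\<exists>a\<le>e. t = r + m * a))" for t
  proof (rule ccontr)
    assume "T t \<noteq> 0"
    then have 1: "(i + t) mod m = (i + r) mod m" and 2: "s \<le> l - t"
      by (auto simp: T_def entry_pathmat_mult[OF y] split: if_splits)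
    from 1 have "t mod m = r mod m" unfolding nat_mod_eq_iff by (simp add: add.assoc)
    then have "t mod m = r" using r by simp
    then obtain a where a: "t = r + m * a" by (metis mod_mult_div_eq)
    have tsl: "t + s \<le> l" using 2 that(1) by linarith
    have "l + m * d = c + m * k" using cd by (simp add: l_def)
    then have 3: "(l - (t + s)) + m * a + m * d = r' + m * k"
      using tsl by (simp add: a c_def)
    have "(l - (t + s)) mod m = r'"
      using arg_cong[OF 3, of "\<lambda>x. x mod m"] r' by simp
    then obtain b where b: "l - (t + s) = r' + m * b" by (metis mod_mult_div_eq)
    then have "l = c + m * (a + b)" using tsl by (simp add: a c_def algebra_simps)
    with a that(2) show False by (metis le_add1)
  qed
  have "coeff (entry_poly (u * (pathmat (i + r) s * y)) i (c mod m)) k = (\<Sum>t=0..l. T t)"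
    by (simp add: coeff_entry_poly[OF per] l_def[symmetric] T_def) (simp add: entry_mult)
  also have "\<dots> = coeff (monom 1 d * (entry_poly u i r * entry_poly y i' r')) k"
  proof (cases "d \<le> k")
    case False
    have "l < c"
    proof -
      have "m * k < m * d" using False m_pos by simp
      then show ?thesis using cd unfolding l_def by linarith
    qed
    then have "(\<Sum>t=0..l. T t) = 0" using T0 by (intro sum.neutral) auto
    then show ?thesis using False by (simp add: coeff_monom_mult)
  next
    case True
    then obtain e where k: "k = d + e" using le_Suc_ex by blast
    have l: "l = c + m * e" using cd by (simp add: l_def k algebra_simps)
    have e_unique: "e' = e" if "l = c + m * e'" for e' using that l m_pos by simp
    have "(\<Sum>t=0..l. T t) = (\<Sum>t\<in>(\<lambda>a. r + m * a) ` {..e}. T t)"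
    proof (rule sum.mono_neutral_right)
      show "(\<lambda>a. r + m * a) ` {..e} \<subseteq> {0..l}"
      proof
        fix t assume "t \<in> (\<lambda>a. r + m * a) ` {..e}"
        then obtain a where a: "a \<le> e" "t = r + m * a" by auto
        have "m * a \<le> m * e" using a(1) by (rule mult_le_mono2)
        then show "t \<in> {0..l}" unfolding a(2) l c_def atLeastAtMost_iff by linarith
      qed
      show "\<forall>t\<in>{0..l} - (\<lambda>a. r + m * a) ` {..e}. T t = 0"
        using T0 e_unique by fastforce
    qed simp
    also have "\<dots> = (\<Sum>a\<le>e. T (r + m * a))"
      using m_pos by (subst sum.reindex) (auto simp: inj_on_def)
    also have "\<dots> = (\<Sum>a\<le>e. coeff (entry_poly u i r) a * coeff (entry_poly y i' r') (e - a))"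
    proof (intro sum.cong refl)
      fix a assume "a \<in> {..e}"
      then obtain b where e: "e = a + b" using le_Suc_ex by auto
      have "l - (r + m * a) = s + r' + m * b" by (simp add: l c_def e algebra_simps)
      moreover have "(i + (r + m * a)) mod m = (i + r) mod m" by (simp add: add.assoc[symmetric])
      ultimately have "T (r + m * a) = entry u i (r + m * a) * entry y (i + r + s) (r' + m * b)"
        by (simp add: T_def entry_pathmat_mult[OF y] add_ac)
      also have "entry y (i + r + s) (r' + m * b) = entry y i' (r' + m * b)"
        by (rule periodic_cong[OF y js])
      finally show "T (r + m * a) = coeff (entry_poly u i r) a * coeff (entry_poly y i' r') (e - a)"
        by (simp add: coeff_entry_poly u y e)
    qed
    also have "\<dots> = coeff (monom 1 d * (entry_poly u i r * entry_poly y i' r')) k"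
      by (simp add: coeff_monom_mult k coeff_mult[of "entry_poly u i r"])
    finally show ?thesis .
  qed
  finally show "coeff (entry_poly (u * (pathmat (i + r) s * y)) i ((r + s + r') mod m)) k
    = coeff (monom 1 ((r + s + r') div m) * (entry_poly u i r * entry_poly y i' r')) k"
    by (simp only: c_def d_def)
qed

text \<open>Over the field \<open>\<k>[z]/(p)\<close> the periodic matrices form a full matrix algebra, because \<open>z\<close> is
  invertible there; its zero ideal is prime. Concretely, \<open>p\<close> divides all products of an entry
  polynomial of \<open>u\<close> with one of \<open>y\<close>, up to a power of the variable, which is coprime to \<open>p\<close>.\<close>

lemma prime_zpoly_dvd:
  assumes u: "periodic u" and y: "periodic y" and p: "prime_elem p" "coeff p 0 \<noteq> 0"
    and dvd: "\<And>i s. 0 < s \<Longrightarrow> \<exists>w. periodic w \<and> u * (pathmat i s * y) = zpoly p * w"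
  shows "(\<exists>b. periodic b \<and> u = zpoly p * b) \<or> (\<exists>b. periodic b \<and> y = zpoly p * b)"
proof (cases "\<forall>i r. r < m \<longrightarrow> p dvd entry_poly u i r")
  case True
  then show ?thesis using zpoly_dvdI[OF u, of p] p by auto
next
  case False
  then obtain i r where ir: "r < m" "\<not> p dvd entry_poly u i r" by auto
  have "p dvd entry_poly y i' r'" if r': "r' < m" for i' r'
  proof -
    \<comment> \<open>The length of a path from position \<open>i + r\<close> to position \<open>i'\<close>, made positive by a multiple of \<open>m\<close>.\<close>
    define s where "s = i' + m * (i + r + 1) - (i + r)"
    have "i + r < m * (i + r + 1)" using m_pos
      by (metis Suc_eq_plus1 le_refl less_Suc_eq_le less_le_trans mult_le_mono1 nat_mult_1 Suc_leI One_nat_def)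
    then have s: "0 < s" "i + r + s = i' + m * (i + r + 1)" by (auto simp: s_def)
    then have js: "(i + r + s) mod m = i' mod m" by (metis mod_mult_self2)
    obtain w where w: "periodic w" "u * (pathmat (i + r) s * y) = zpoly p * w"
      using dvd[OF s(1)] by blast
    have "p dvd monom 1 ((r + s + r') div m) * (entry_poly u i r * entry_poly y i' r')"
      using entry_poly_sandwich[OF u y ir(1) r' js] entry_poly_zpoly_mult[OF w(1), of "(r + s + r') mod m" p i]
        m_pos w(2) by (metis dvd_triv_left mod_less_divisor)
    moreover have "\<not> p dvd monom 1 n" for n
    proof
      assume "p dvd monom 1 n"
      then have "p dvd [:0, 1:] ^ n" by (simp add: monom_altdef)
      then have "p dvd [:0, 1:]" using p(1) prime_elem_dvd_power by blast
      then obtain b where b: "[:0, 1:] = p * b" by (auto elim: dvdE)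
      then have "coeff (p * b) 0 = 0" by (metis coeff_pCons_0)
      then have "coeff b 0 = 0" using p(2) by (simp add: coeff_mult)
      then obtain b' where b': "b = [:0, 1:] * b'" by (metis dvdE poly_0_coeff_0 poly_eq_0_iff_dvd minus_zero)
      have "[:0, 1:] * (p * b') = p * ([:0, 1:] * b')" by (rule mult.left_commute)
      then have "[:0, 1:] * (p * b') = [:0, 1:] * 1" unfolding b'[symmetric] b[symmetric] by (simp only: mult_1_right)
      then have "p * b' = 1" by (metis mult_left_cancel pCons_eq_0_iff zero_neq_one)
      then have "is_unit p" by (metis dvd_triv_left)
      then show False using p(1) by (simp add: prime_elem_def)
    qed
    ultimately show ?thesis using p(1) ir(2) by (simp add: prime_elem_dvd_mult_iff)
  qed
  then show ?thesis using zpoly_dvdI[OF y, of p] p by auto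
qed

end

text \<open>A nonconstant factor of least degree is irreducible; it can be scaled because its constant
  coefficient divides \<open>1\<close>.\<close>

lemma exists_irreducible_factor:
  fixes q :: "'k::field poly"
  assumes "0 < degree q" and q0: "coeff q 0 = 1"
  shows "\<exists>p. prime_elem p \<and> p dvd q \<and> coeff p 0 = 1 \<and> 0 < degree p"
proof -
  define P where "P n \<longleftrightarrow> (\<exists>p. p dvd q \<and> degree p = n \<and> 0 < n)" for n
  have "P (degree q)" unfolding P_def using assms by (intro exI[of _ q]) simp
  then obtain n where n: "P n" "\<And>k. k < n \<Longrightarrow> \<not> P k"
    using exists_least_iff[of P] by blast
  then obtain p0 where p0: "p0 dvd q" "degree p0 = n" "0 < n" by (auto simp: P_def)
  from p0(1) have c: "coeff p0 0 \<noteq> 0" using q0 by (auto simp: coeff_mult elim!: dvdE)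
  define p where "p = Polynomial.smult (inverse (coeff p0 0)) p0"
  have p: "p dvd q" "degree p = n" "coeff p 0 = 1"
    using p0 c by (auto simp: p_def smult_dvd_iff)
  have q: "q \<noteq> 0" using q0 by auto
  have "irreducible p"
  proof (rule Factorial_Ring.irreducibleI)
    show "p \<noteq> 0" using p p0 by auto
    show "\<not> is_unit p" using p p0 by (auto simp: is_unit_iff_degree[OF \<open>p \<noteq> 0\<close>])
    fix a b assume ab: "p = a * b"
    show "is_unit a \<or> is_unit b"
    proof (rule ccontr)
      assume "\<not> ?thesis"
      moreover have ne: "a \<noteq> 0" "b \<noteq> 0" using \<open>p \<noteq> 0\<close> ab by auto
      ultimately have d: "degree a > 0" "degree b > 0" by (auto simp: is_unit_iff_degree)
      then have "degree a < n" using p(2) ne by (simp add: ab degree_mult_eq)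
      moreover have "P (degree a)" using d p(1) ab by (auto simp: P_def intro: dvd_mult_left)
      ultimately show False using n by blast
    qed
  qed
  then have "prime_elem p" by (rule field_poly_irreducible_imp_prime)
  with p p0 show ?thesis by blast
qed

section \<open>Endomorphisms and the filtration by degree\<close>

context glued_cycle
begin

lemma diag_comp_mult:
  "diag_comp l (a * b) = (\<Sum>s=0..l. diag_comp s a * diag_comp (l - s) b)"
proof (rule utmat_eqI)
  fix i k
  have "entry (diag_comp s a * diag_comp (l - s) b) i k
      = (if k = l then entry a i s * entry b (i + s) (l - s) else 0)" if "s \<le> l" for s
  proof -
    have "entry (diag_comp s a * diag_comp (l - s) b) i k
        = (\<Sum>t=0..k. if t = s then (if k = l then entry a i s * entry b (i + s) (l - s) else 0) else 0)"
      unfolding entry_mult using that by (intro sum.cong) auto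
    then show ?thesis using that by simp
  qed
  then show "entry (diag_comp l (a * b)) i k
      = entry (\<Sum>s=0..l. diag_comp s a * diag_comp (l - s) b) i k"
    by (auto simp: entry_sum entry_mult)
qed

lemma diag_comp_add: "diag_comp l (a + b) = diag_comp l a + diag_comp l b"
  by (rule utmat_eqI) simp

lemma diag_comp_scal: "diag_comp l (scal c a) = scal c (diag_comp l a)"
  by (rule utmat_eqI) simp

lemma diag_comp_1: "diag_comp l 1 = (if l = 0 then 1 else 0)"
  by (rule utmat_eqI) (simp add: entry_1)

lemma diag_comp_diag_comp: "diag_comp l (diag_comp n a) = (if l = n then diag_comp n a else 0)"
  by (rule utmat_eqI) simp

lemma entry_z_mult:
  assumes "periodic a"
  shows "entry (zpoly [:0, 1:] * a) i (l + m) = entry a i l"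
proof -
  have "entry (zpoly [:0, 1:] * a) i (l + m) = (\<Sum>k\<le>(l + m) div m. if k = 1 then entry a i l else 0)"
    unfolding entry_zpoly_mult[OF assms]
  proof (intro sum.cong refl)
    fix k
    show "coeff [:0, 1:] k * entry a i (l + m - m * k) = (if k = 1 then entry a i l else 0)"
    proof (cases k)
      case (Suc k')
      then show ?thesis by (cases k') simp_all
    qed simp
  qed
  also have "\<dots> = entry a i l" using m_pos by simp
  finally show ?thesis .
qed

lemma low_zero_remainder: "low_zero n a \<Longrightarrow> low_zero (Suc n) (a - diag_comp n a)"
  by (auto simp: low_zero_def less_Suc_eq)

end

locale order_hom = glued_cycle m \<tau> for m and \<tau> :: "nat \<Rightarrow> 'v" +
  fixes F :: "'k::field utmat \<Rightarrow> 'k utmat"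
  assumes closed [simp]: "a \<in> glued_order \<Longrightarrow> F a \<in> glued_order"
    and hom_add: "a \<in> glued_order \<Longrightarrow> b \<in> glued_order \<Longrightarrow> F (a + b) = F a + F b"
    and hom_mult: "a \<in> glued_order \<Longrightarrow> b \<in> glued_order \<Longrightarrow> F (a * b) = F a * F b"
    and hom_scal: "a \<in> glued_order \<Longrightarrow> F (scal c a) = scal c (F a)"
    and hom_1 [simp]: "F 1 = 1"
begin

lemma hom_0 [simp]: "F 0 = 0"
proof -
  have "scal 0 (0::'k utmat) = 0" by (rule utmat_eqI) simp
  then have "F 0 = scal 0 (F 0)" by (metis hom_scal order_0)
  also have "\<dots> = 0" by (rule utmat_eqI) simp
  finally show ?thesis .
qed

lemma hom_diff: "a \<in> glued_order \<Longrightarrow> b \<in> glued_order \<Longrightarrow> F (a - b) = F a - F b"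
  using hom_add[of "a - b" b] by (simp add: algebra_simps)

lemma hom_sum: "(\<And>x. x \<in> S \<Longrightarrow> f x \<in> glued_order) \<Longrightarrow> F (sum f S) = (\<Sum>x\<in>S. F (f x))"
proof (induction S rule: infinite_finite_induct)
  case (insert x S)
  then show ?case by (simp add: hom_add order_sum)
qed auto

lemma hom_periodic [simp]: "a \<in> glued_order \<Longrightarrow> periodic (F a)"
  by (simp add: order_periodic)

text \<open>The image of an arrow squares to \<open>0\<close>, and diagonal \<open>0\<close> is multiplicative with values in a
  field.\<close>

lemma hom_arrow_low:
  assumes "2 \<le> m" shows "low_zero 1 (F (pathmat i 1))"
  unfolding low_zero_def
proof (intro allI impI)
  fix j l :: nat assume "l < 1"
  have "F (pathmat i 1) * F (pathmat i 1) = F (pathmat i 1 * pathmat i 1)"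
    by (rule hom_mult[symmetric]) simp_all
  also have "\<dots> = 0" using arrow_square[OF assms, of i, where 'k='k] by simp
  finally have "entry (F (pathmat i 1) * F (pathmat i 1)) j 0 = 0" by simp
  then show "entry (F (pathmat i 1)) j l = 0" using \<open>l < 1\<close> by (simp add: entry_mult_0)
qed

text \<open>By expansion along arrows, an element of degree at least \<open>n + 1\<close> is a combination of arrows with
  coefficients of degree at least \<open>n\<close>.\<close>

lemma hom_low_zero:
  assumes m: "2 \<le> m" shows "a \<in> glued_order \<Longrightarrow> low_zero n a \<Longrightarrow> low_zero n (F a)"
proof (induction n arbitrary: a)
  case (Suc n)
  have per: "periodic a" using Suc.prems order_periodic by blast
  have "low_zero 1 a" using Suc.prems(2) by (rule low_zero_mono) simp
  then have "F a = F (\<Sum>i<m. pathmat i 1 * const_rows i a)"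
    using arrow_expansion[OF per] by simp
  also have "\<dots> = (\<Sum>i<m. F (pathmat i 1 * const_rows i a))"
    by (intro hom_sum order_mult const_rows_order per) simp
  also have "\<dots> = (\<Sum>i<m. F (pathmat i 1) * F (const_rows i a))"
    by (intro sum.cong refl hom_mult const_rows_order per) simp
  finally have *: "F a = (\<Sum>i<m. F (pathmat i 1) * F (const_rows i a))" .
  have "low_zero n (F (const_rows i a))" for i
    using Suc.prems(2) by (intro Suc.IH const_rows_order per) (auto simp: low_zero_def const_rows_def)
  then have "low_zero (1 + n) (F (pathmat i 1) * F (const_rows i a))" for i
    by (intro low_zero_mult hom_arrow_low m)
  then have "low_zero (1 + n) (F a)" unfolding * by (intro low_zero_sum) auto
  then show ?case by simp
qed simp

lemma hom_entry_low:
  assumes "2 \<le> m" "a \<in> glued_order" "low_zero n a"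
  shows "entry (F a) i n = entry (F (diag_comp n a)) i n"
proof -
  have "low_zero (Suc n) (F (a - diag_comp n a))"
    using assms by (intro hom_low_zero low_zero_remainder) auto
  then show ?thesis using assms by (simp add: hom_diff low_zero_def)
qed

text \<open>On polynomials in \<open>z\<close> a homomorphism is substitution of the image of \<open>z\<close>.\<close>

lemma hom_zpoly:
  assumes "F (zpoly [:0, 1:]) = zpoly g"
  shows "F (zpoly q) = zpoly (pcompose q g)"
proof (induction q)
  case (pCons c q)
  have "zpoly (pCons c q) = scal c 1 + zpoly [:0, 1:] * (zpoly q :: 'k utmat)"
    by (simp add: zpoly_const[symmetric] zpoly_mult[symmetric] zpoly_add[symmetric])
  then have "F (zpoly (pCons c q)) = scal c 1 + zpoly g * zpoly (pcompose q g)"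
    by (simp add: hom_add hom_mult hom_scal assms pCons)
  also have "\<dots> = zpoly (pcompose (pCons c q) g)"
    by (simp add: zpoly_const[symmetric] zpoly_mult[symmetric] zpoly_add[symmetric] pcompose_pCons)
  finally show ?case .
qed simp

text \<open>The map induced on the associated graded algebra, which is identified with the algebra itself
  because the filtration comes from a grading.\<close>

definition assoc_graded :: "'k utmat \<Rightarrow> 'k utmat"
  where "assoc_graded a = UTMat (\<lambda>i l. entry (F (diag_comp l a)) i l)"

lemma entry_assoc_graded: "entry (assoc_graded a) i l = entry (F (diag_comp l a)) i l"
  by (simp add: assoc_graded_def)

lemma assoc_graded_diag_comp: "assoc_graded (diag_comp n a) = diag_comp n (assoc_graded a)"
  by (rule utmat_eqI) (simp add: entry_assoc_graded diag_comp_diag_comp)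

lemma assoc_graded_closed:
  assumes a: "a \<in> glued_order" shows "assoc_graded a \<in> glued_order"
proof -
  obtain N where N: "\<forall>i. \<forall>l>N. entry a i l = 0"
    using order_periodic[OF a] by (auto simp: periodic_def)
  have "entry (assoc_graded a) i l = 0" if "l > N" for i l
  proof -
    have "diag_comp l a = 0" using N that by (intro utmat_eqI) auto
    then show ?thesis by (simp add: entry_assoc_graded)
  qed
  moreover have "entry (assoc_graded a) (i + m) l = entry (assoc_graded a) i l" for i l
    using a by (simp add: entry_assoc_graded periodic_shift)
  ultimately have "periodic (assoc_graded a)" unfolding periodic_def by blast
  moreover have "entry (assoc_graded a) i 0 = entry (assoc_graded a) j 0" if "\<tau> i = \<tau> j" for i j
    using a order_glue[OF _ that] by (metis entry_assoc_graded closed order_diag_comp)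
  ultimately show ?thesis unfolding mem_order_iff by blast
qed

text \<open>Multiplicativity holds because leading diagonals multiply.\<close>

lemma order_hom_assoc_graded:
  assumes m: "2 \<le> m" shows "order_hom m \<tau> assoc_graded"
proof
  fix a b :: "'k utmat" assume a: "a \<in> glued_order" and b: "b \<in> glued_order"
  show "assoc_graded (a + b) = assoc_graded a + assoc_graded b"
    using a b by (intro utmat_eqI) (simp add: entry_assoc_graded diag_comp_add hom_add)
  show "assoc_graded (a * b) = assoc_graded a * assoc_graded b"
  proof (rule utmat_eqI)
    fix i l
    have "entry (F (diag_comp s a) * F (diag_comp (l - s) b)) i l
      = entry (F (diag_comp s a)) i s * entry (F (diag_comp (l - s) b)) (i + s) (l - s)" if "s \<le> l" for s
      using entry_mult_low[of s "F (diag_comp s a)" "l - s" "F (diag_comp (l - s) b)" i] that a b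
        hom_low_zero[OF m _ low_zero_diag_comp] by simp
    then show "entry (assoc_graded (a * b)) i l = entry (assoc_graded a * assoc_graded b) i l"
      using a b
      by (simp add: entry_assoc_graded diag_comp_mult hom_sum hom_mult entry_sum
          entry_mult[of "assoc_graded a"])
  qed
qed (auto intro!: utmat_eqI simp: assoc_graded_closed entry_assoc_graded diag_comp_scal hom_scal diag_comp_1 entry_1)

end

locale order_auto = order_hom m \<tau> F + inv: order_hom m \<tau> G
  for m and \<tau> :: "nat \<Rightarrow> 'v" and F G :: "'k::field utmat \<Rightarrow> 'k utmat" +
  assumes GF [simp]: "a \<in> glued_order \<Longrightarrow> G (F a) = a"
    and FG [simp]: "a \<in> glued_order \<Longrightarrow> F (G a) = a"
begin

lemma swap: "order_auto m \<tau> G F"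
  by unfold_locales auto

text \<open>An automorphism preserves the centre, and central elements are polynomials in \<open>z\<close>.\<close>

lemma image_zpoly: "\<exists>g. F (zpoly [:0, 1:]) = zpoly g"
proof (rule central_imp_zpoly)
  fix i
  have "pathmat i 1 * F (zpoly [:0, 1:]) = F (G (pathmat i 1)) * F (zpoly [:0, 1:])" by simp
  also have "\<dots> = F (G (pathmat i 1) * zpoly [:0, 1:])" by (rule hom_mult[symmetric]) simp_all
  also have "G (pathmat i 1) * zpoly [:0, 1:] = zpoly [:0, 1:] * G (pathmat i 1)"
    by (rule zpoly_central) simp
  also have "F \<dots> = F (zpoly [:0, 1:]) * F (G (pathmat i 1))" by (rule hom_mult) simp_all
  finally show "pathmat i 1 * F (zpoly [:0, 1:]) = F (zpoly [:0, 1:]) * pathmat i 1" by simp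
qed simp

text \<open>The filtered form of the condition that defines the automorphisms acting as the identity on the
  associated graded algebra. Unlike the condition on homogeneous elements it passes to inverses at
  once.\<close>

definition graded_trivial :: bool
  where "graded_trivial \<longleftrightarrow> (\<forall>n. \<forall>a\<in>glued_order. low_zero n a \<longrightarrow> low_zero (Suc n) (F a - a))"

end

lemma (in order_auto) graded_trivial_inverse:
  assumes m: "2 \<le> m" and triv: "graded_trivial"
  shows "order_auto.graded_trivial m \<tau> G"
  unfolding order_auto.graded_trivial_def[OF swap]
proof (intro allI ballI impI)
  fix n and a :: "'k utmat" assume a: "a \<in> glued_order" "low_zero n a"
  have "low_zero (Suc n) (F (G a) - G a)"
    using triv[unfolded graded_trivial_def] inv.hom_low_zero[OF m a] inv.closed[OF a(1)] by blast
  then show "low_zero (Suc n) (G a - a)"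
    using a by (auto simp: low_zero_def)
qed

context order_auto
begin

lemma graded_trivialI:
  assumes m: "2 \<le> m"
    and *: "\<And>n a. a \<in> glued_order \<Longrightarrow> diag_comp n a = a \<Longrightarrow> diag_comp n (F a) = a"
  shows graded_trivial
  unfolding graded_trivial_def
proof (intro allI ballI impI)
  fix n and a :: "'k utmat" assume a: "a \<in> glued_order" "low_zero n a"
  have l: "low_zero n (F a)" using hom_low_zero[OF m a] .
  have "entry (F a) i n = entry a i n" for i
  proof -
    have "diag_comp n (F (diag_comp n a)) = diag_comp n a"
      using a by (intro *) (simp_all add: diag_comp_diag_comp)
    then have "entry (F (diag_comp n a)) i n = entry a i n"
      by (metis entry_diag_comp)
    then show ?thesis using hom_entry_low[OF m a] by simp
  qed
  then show "low_zero (Suc n) (F a - a)"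
    using l a by (auto simp: low_zero_def less_Suc_eq)
qed

lemma unipotent_image:
  assumes triv: graded_trivial and a: "a \<in> glued_order" "\<And>i. entry a i 0 = 1"
  shows "entry (F a) i 0 = 1"
proof -
  have "low_zero (Suc 0) (F a - a)" using triv a by (simp add: graded_trivial_def)
  then show ?thesis using a(2) by (auto simp: low_zero_def)
qed

text \<open>If \<open>F z = g(z)\<close> and \<open>G z = h(z)\<close>, then \<open>h \<circ> g\<close> is the identity polynomial, so \<open>g\<close> has
  degree \<open>1\<close>. Its coefficients are read off from the degrees \<open>0\<close> and \<open>m\<close>, where \<open>F\<close> is
  trivial.\<close>

lemma fixes_centre:
  assumes m: "2 \<le> m" and triv: graded_trivial
  shows "F (zpoly q) = zpoly q"
proof -
  obtain g where g: "F (zpoly [:0, 1:]) = zpoly g" using image_zpoly by blast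
  obtain h where h: "G (zpoly [:0, 1:]) = zpoly h" using order_auto.image_zpoly[OF swap] by blast
  have "zpoly [:0, 1:] = F (G (zpoly [:0, 1:]))" by simp
  also have "\<dots> = zpoly (pcompose h g)" unfolding h by (rule hom_zpoly[OF g])
  finally have hg: "pcompose h g = [:0, 1:]" by (metis zpoly_inj)
  then have "degree h * degree g = 1" by (metis degree_pcompose degree_pCons_eq_if one_neq_zero pCons_eq_0_iff degree_0 One_nat_def)
  then have deg: "degree g = 1" by simp
  have low: "low_zero m (zpoly [:0, 1:] :: 'k utmat)"
    unfolding low_zero_def
  proof (intro allI impI)
    fix i l assume "l < m"
    then show "entry (zpoly [:0, 1::'k:]) i l = 0"
      by (cases "l = 0") (auto simp: entry_zpoly dest: dvd_imp_le)
  qed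
  then have "low_zero (Suc m) (zpoly g - zpoly [:0, 1:])"
    using triv g by (metis graded_trivial_def zpoly_order)
  moreover have "Suc m > 0" "Suc m > m" by simp_all
  ultimately have "entry (zpoly g - zpoly [:0, 1:]) 0 0 = 0" "entry (zpoly g - zpoly [:0, 1:]) 0 m = 0"
    unfolding low_zero_def by blast+
  then have "coeff g 0 = 0" "coeff g 1 = 1" using m_pos by (simp_all add: entry_zpoly)
  then have "g = [:0, 1:]" using deg
    by (intro poly_eqI) (auto simp: coeff_pCons coeff_eq_0 split: nat.split)
  then show ?thesis using hom_zpoly[OF g, of q] by simp
qed

text \<open>With matrix units \<open>e\<^sub>i\<^sub>j\<close> the Skolem-Noether element is the sum of all \<open>e\<^sub>i\<^sub>0 F(e\<^sub>0\<^sub>i)\<close>, whose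
  row \<open>i\<close> is row \<open>0\<close> of \<open>F(e\<^sub>0\<^sub>i)\<close>. Here the path of length \<open>i + m\<close> from position \<open>0\<close> replaces
  \<open>e\<^sub>0\<^sub>i\<close>, and the shift by its length compensates for this. Periodicity of the resulting matrix is
  the identity \<open>F z = z\<close>, and the intertwining relation in row \<open>i\<close> is row \<open>0\<close> of
  \<open>F (p x) = F p * F x\<close> for this path \<open>p\<close>.\<close>

lemma intertwiner:
  assumes m: "2 \<le> m" and triv: graded_trivial
  shows "\<exists>u\<in>glued_order. (\<forall>i. entry u i 0 = 1) \<and> (\<forall>x\<in>glued_order. x * u = u * F x)"
proof -
  define P where "P i = F (pathmat 0 i)" for i
  \<comment> \<open>The extra \<open>m\<close> keeps the path nonstationary for \<open>i = 0\<close>, since the idempotent at position \<open>0\<close>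
    need not lie in the glued algebra.\<close>
  define u where "u = UTMat (\<lambda>i l. entry (P (i + m)) 0 (l + i + m))"
  have u: "entry u i l = entry (P (i + m)) 0 (l + i + m)" for i l by (simp add: u_def)
  have P_order: "P i \<in> glued_order" if "0 < i" for i using that by (simp add: P_def)
  have P_low: "low_zero i (P i)" if "0 < i" for i
    unfolding P_def using that by (intro hom_low_zero m) (simp_all add: low_zero_def entry_pathmat)
  have pm: "(pathmat 0 (i + m) :: 'k utmat) = pathmat 0 i * zpoly [:0, 1:]" for i
  proof (rule utmat_eqI)
    fix j l
    have "i + m \<le> l \<or> l < i + m" by linarith
    then show "entry (pathmat 0 (i + m)) j l = entry (pathmat 0 i * zpoly [:0, 1::'k:]) j l"
      using m_pos
      by (auto simp: entry_pathmat_mult[OF zpoly_periodic] entry_pathmat entry_zpoly coeff_pCons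
          split: nat.split)
  qed
  have "entry u (i + m) l = entry u i l" for i l
  proof -
    have "P (i + m + m) = F (pathmat 0 (i + m) * zpoly [:0, 1:])" by (simp only: P_def pm)
    also have "\<dots> = P (i + m) * zpoly [:0, 1:]"
      using m_pos by (subst hom_mult) (simp_all add: fixes_centre[OF m triv] P_def)
    also have "\<dots> = zpoly [:0, 1:] * P (i + m)"
      using m_pos by (intro zpoly_central order_periodic P_order) simp
    finally have "entry u (i + m) l = entry (zpoly [:0, 1:] * P (i + m)) 0 ((l + i + m) + m)"
      by (simp add: u add_ac)
    also have "\<dots> = entry u i l"
      unfolding u using m_pos by (intro entry_z_mult order_periodic P_order) simp
    finally show ?thesis .
  qed
  moreover have "\<exists>N. \<forall>i. \<forall>l>N. entry u i l = 0"
  proof -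
    have "\<forall>i. \<exists>N. \<forall>l>N. entry (P (i + m)) 0 l = 0"
      using order_periodic[OF P_order] m_pos unfolding periodic_def by (metis add_gr_0)
    then obtain N where N: "\<And>i l. l > N i \<Longrightarrow> entry (P (i + m)) 0 l = 0" by metis
    have mod: "entry u (i mod m) l = entry u i l" for i l
    proof -
      have "entry u (j + k * m) l = entry u j l" for j k
        by (induction k) (simp_all add: add.assoc[symmetric] add.commute[of m] \<open>\<And>l i. entry u (i + m) l = entry u i l\<close>)
      from this[of "i mod m" "i div m"] show ?thesis by (simp add: mod_div_mult_eq)
    qed
    have "entry u i l = 0" if "l > Max (N ` {..<m})" for i l
    proof -
      have "N (i mod m) \<le> Max (N ` {..<m})" using m_pos by (intro Max_ge) auto
      then have "N (i mod m) < l + i mod m + m" using that by linarith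
      then have "entry u (i mod m) l = 0" unfolding u by (rule N)
      then show ?thesis by (simp add: mod)
    qed
    then show ?thesis by blast
  qed
  ultimately have per: "periodic u" unfolding periodic_def by blast
  have u0: "entry u i 0 = 1" for i
  proof -
    have im: "0 < i + m" using m_pos by simp
    have "low_zero (i + m) (pathmat 0 (i + m) :: 'k utmat)"
      by (simp add: low_zero_def entry_pathmat)
    then have "low_zero (Suc (i + m)) (P (i + m) - pathmat 0 (i + m))"
      unfolding P_def using triv[unfolded graded_trivial_def] order_pathmat[OF im] by blast
    then have "entry (P (i + m)) 0 (i + m) = 1"
      by (simp add: low_zero_def entry_pathmat)
    then show ?thesis by (simp add: u)
  qed
  have "u \<in> glued_order" using per u0 by (rule order_const)
  moreover have "x * u = u * F x" if x: "x \<in> glued_order" for x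
  proof (rule utmat_eqI)
    fix i l
    have im: "0 < i + m" using m_pos by simp
    obtain N where N: "\<forall>i. \<forall>l>N. entry x i l = 0"
      using order_periodic[OF x] by (auto simp: periodic_def)
    \<comment> \<open>The path selects row \<open>i\<close> of \<open>x\<close>; the bound \<open>N + l\<close> covers the whole row and all degrees up to
      \<open>l\<close>.\<close>
    have "pathmat 0 (i + m) * x = (\<Sum>s=0..N + l. scal (entry x i s) (pathmat 0 (i + m + s)))"
    proof (rule utmat_eqI)
      fix j k
      have "entry (pathmat 0 (i + m) * x) j k
          = (if j mod m = 0 \<and> i + m \<le> k then entry x i (k - (i + m)) else 0)"
        using periodic_shift[OF order_periodic[OF x], of i]
        by (simp add: entry_pathmat_mult[OF order_periodic[OF x]])
      also have "\<dots> = (\<Sum>s=0..N + l. if s = k - (i + m) then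
          (if j mod m = 0 \<and> i + m \<le> k then entry x i (k - (i + m)) else 0) else 0)"
        using N by simp
      also have "\<dots> = entry (\<Sum>s=0..N + l. scal (entry x i s) (pathmat 0 (i + m + s))) j k"
        unfolding entry_sum by (intro sum.cong) (auto simp: entry_pathmat)
      finally show "entry (pathmat 0 (i + m) * x) j k
        = entry (\<Sum>s=0..N + l. scal (entry x i s) (pathmat 0 (i + m + s))) j k" .
    qed
    then have "F (pathmat 0 (i + m) * x) = (\<Sum>s=0..N + l. scal (entry x i s) (P (i + m + s)))"
      using im by (simp add: hom_sum hom_scal P_def)
    moreover have "F (pathmat 0 (i + m) * x) = P (i + m) * F x"
      using im x by (simp add: hom_mult P_def)
    ultimately have key: "entry (P (i + m) * F x) 0 (l + i + m)
        = (\<Sum>s=0..N + l. entry x i s * entry (P (i + m + s)) 0 (l + i + m))"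
      by (simp add: entry_sum)
    have "entry (x * u) i l = (\<Sum>s=0..l. entry x i s * entry (P (i + m + s)) 0 (l + i + m))"
      unfolding entry_mult by (intro sum.cong) (auto simp: u add_ac)
    also have "\<dots> = (\<Sum>s=0..N + l. entry x i s * entry (P (i + m + s)) 0 (l + i + m))"
    proof (rule sum.mono_neutral_left)
      show "\<forall>s\<in>{0..N + l} - {0..l}. entry x i s * entry (P (i + m + s)) 0 (l + i + m) = 0"
      proof
        fix s assume "s \<in> {0..N + l} - {0..l}"
        then have "l + i + m < i + m + s" "0 < i + m + s" using im by auto
        then show "entry x i s * entry (P (i + m + s)) 0 (l + i + m) = 0"
          using P_low[of "i + m + s"] by (simp add: low_zero_def)
      qed
    qed auto
    also have "\<dots> = (\<Sum>t=0..l + (i + m). entry (P (i + m)) 0 t * entry (F x) t (l + (i + m) - t))"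
      unfolding key[symmetric] by (simp add: entry_mult add.assoc)
    also have "\<dots> = (\<Sum>t=i + m..l + (i + m). entry (P (i + m)) 0 t * entry (F x) t (l + (i + m) - t))"
      using P_low[OF im] by (intro sum.mono_neutral_right) (auto simp: low_zero_def)
    also have "\<dots> = (\<Sum>s=0..l. entry (P (i + m)) 0 (s + (i + m)) * entry (F x) (s + (i + m)) (l - s))"
      using sum.shift_bounds_cl_nat_ivl[of "\<lambda>t. entry (P (i + m)) 0 t * entry (F x) t (l + (i + m) - t)" 0 "i + m" l]
      by simp
    also have "\<dots> = entry (u * F x) i l"
    proof -
      have "entry (F x) (s + (i + m)) k = entry (F x) (i + s) k" for s k
        using periodic_shift[OF hom_periodic[OF x], of "i + s" k] by (simp only: ac_simps)
      then show ?thesis by (simp add: entry_mult u add_ac)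
    qed
    finally show "entry (x * u) i l = entry (u * F x) i l" .
  qed
  ultimately show ?thesis using u0 by blast
qed

text \<open>An intertwiner \<open>u\<close> together with an inverse up to the central factor \<open>q\<close>.\<close>

definition intertwiner_pair :: "'k utmat \<Rightarrow> 'k utmat \<Rightarrow> 'k poly \<Rightarrow> bool"
  where "intertwiner_pair u y q \<longleftrightarrow> u \<in> glued_order \<and> y \<in> glued_order \<and> (\<forall>i. entry u i 0 = 1) \<and> (\<forall>i. entry y i 0 = 1) \<and>
    (\<forall>x\<in>glued_order. x * u = u * F x) \<and> (\<forall>x\<in>glued_order. F x * y = y * x) \<and> u * y = zpoly q"

text \<open>The second component is the image under \<open>F\<close> of an intertwiner for the inverse automorphism. The
  product commutes with all arrows because \<open>x * u * y = u * F x * y = u * y * x\<close>.\<close>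

lemma intertwiner_pair_exists:
  assumes m: "2 \<le> m" and triv: graded_trivial
  shows "\<exists>u y q. intertwiner_pair u y q"
proof -
  obtain u where u: "u \<in> glued_order" "\<And>i. entry u i 0 = 1" "\<And>x. x \<in> glued_order \<Longrightarrow> x * u = u * F x"
    using intertwiner[OF m triv] by blast
  obtain v where v: "v \<in> glued_order" "\<And>i. entry v i 0 = 1" "\<And>x. x \<in> glued_order \<Longrightarrow> x * v = v * G x"
    using order_auto.intertwiner[OF swap m graded_trivial_inverse[OF m triv]] by blast
  have y: "F x * F v = F v * x" if "x \<in> glued_order" for x
  proof -
    have "F x * F v = F (x * v)" using that v(1) by (simp add: hom_mult)
    also have "\<dots> = F v * F (G x)" using that v(1) v(3)[OF that] by (simp add: hom_mult)
    finally show ?thesis using that by simp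
  qed
  have "\<exists>q. u * F v = zpoly q"
  proof (rule central_imp_zpoly)
    fix i
    have "pathmat i 1 * (u * F v) = u * (F (pathmat i 1) * F v)"
      using u(3)[of "pathmat i 1"] by (simp add: mult.assoc[symmetric])
    then show "pathmat i 1 * (u * F v) = u * F v * pathmat i 1"
      using y[of "pathmat i 1"] by (simp add: mult.assoc)
  qed (use u v in \<open>simp add: order_periodic\<close>)
  then obtain q where "u * F v = zpoly q" ..
  then have "intertwiner_pair u (F v) q"
    unfolding intertwiner_pair_def using u y v unipotent_image[OF triv v(1,2)] by auto
  then show ?thesis by blast
qed

text \<open>For every path \<open>w\<close>, writing \<open>w = F (G w)\<close> gives \<open>u * w * y = u * y * G w\<close>, a multiple of the
  central factor. Hence an irreducible divisor of \<open>q\<close> divides one of \<open>u\<close> and \<open>y\<close>, and the quotient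
  satisfies the same relations, as central polynomials can be cancelled.\<close>

lemma intertwiner_pair_reduce:
  assumes "intertwiner_pair u y q" "0 < degree q"
  shows "\<exists>u' y' q'. intertwiner_pair u' y' q' \<and> degree q' < degree q"
proof -
  have u: "u \<in> glued_order" "\<And>i. entry u i 0 = 1" "\<And>x. x \<in> glued_order \<Longrightarrow> x * u = u * F x"
    and y: "y \<in> glued_order" "\<And>i. entry y i 0 = 1" "\<And>x. x \<in> glued_order \<Longrightarrow> F x * y = y * x"
    and uy: "u * y = zpoly q"
    using assms by (auto simp: intertwiner_pair_def)
  note per = order_periodic[OF u(1)] order_periodic[OF y(1)]
  have "coeff q 0 = entry (u * y) 0 0" by (simp add: uy entry_zpoly)
  then have q0: "coeff q 0 = 1" by (simp add: entry_mult_0 u y)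
  obtain p where p: "prime_elem p" "p dvd q" "coeff p 0 = 1" "0 < degree p"
    using exists_irreducible_factor[OF assms(2) q0] by blast
  then obtain q' where q': "q = p * q'" by (auto elim: dvdE)
  have p0: "p \<noteq> 0" and "q' \<noteq> 0" using p q' assms(2) by auto
  then have deg: "degree q' < degree q" using p q' by (simp add: degree_mult_eq)
  have unip: "entry b i 0 = 1" if "entry (zpoly p * b) i 0 = 1" for b i
    using that p(3) by (simp add: entry_mult_0 entry_zpoly)
  have "(\<exists>b. periodic b \<and> u = zpoly p * b) \<or> (\<exists>b. periodic b \<and> y = zpoly p * b)"
  proof (rule prime_zpoly_dvd[OF per p(1)])
    show "coeff p 0 \<noteq> 0" using p by simp
    fix i s :: nat assume s: "0 < s"
    then have "u * (pathmat i s * y) = u * (F (G (pathmat i s)) * y)" by simp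
    also have "\<dots> = (u * y) * G (pathmat i s)" using y(3)[of "G (pathmat i s)"] s by (simp add: mult.assoc)
    also have "\<dots> = zpoly p * (zpoly q' * G (pathmat i s))" by (simp add: uy q' zpoly_mult mult.assoc)
    finally show "\<exists>w. periodic w \<and> u * (pathmat i s * y) = zpoly p * w"
      using s by (intro exI[of _ "zpoly q' * G (pathmat i s)"]) simp
  qed
  then show ?thesis
  proof (elim disjE exE conjE)
    fix b assume b: "periodic b" "u = zpoly p * b"
    have b0: "\<And>i. entry b i 0 = 1" using u(2) unip b(2) by blast
    have "x * b = b * F x" if x: "x \<in> glued_order" for x
    proof (rule zpoly_cancel[OF _ p0])
      have "zpoly p * (x * b) = x * u"
        using zpoly_central[OF order_periodic[OF x], of p] by (simp add: b(2) mult.assoc[symmetric])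
      then show "zpoly p * (x * b) = zpoly p * (b * F x)"
        using u(3)[OF x] by (simp add: b(2) mult.assoc)
    qed (use x b in \<open>simp_all add: order_periodic\<close>)
    moreover have "b * y = zpoly q'"
    proof (rule zpoly_cancel[OF _ p0])
      have "zpoly p * (b * y) = u * y" by (simp add: b(2) mult.assoc)
      then show "zpoly p * (b * y) = zpoly p * zpoly q'" by (simp add: uy q' zpoly_mult)
    qed (use b per in simp_all)
    ultimately have "intertwiner_pair b y q'"
      unfolding intertwiner_pair_def using b0 y order_const[OF b(1) b0] by blast
    with deg show ?thesis by blast
  next
    fix b assume b: "periodic b" "y = zpoly p * b"
    have b0: "\<And>i. entry b i 0 = 1" using y(2) unip b(2) by blast
    have "F x * b = b * x" if x: "x \<in> glued_order" for x
    proof (rule zpoly_cancel[OF _ p0])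
      have "zpoly p * (F x * b) = F x * y"
        using zpoly_central[OF hom_periodic[OF x], of p] by (simp add: b(2) mult.assoc[symmetric])
      then show "zpoly p * (F x * b) = zpoly p * (b * x)"
        using y(3)[OF x] by (simp add: b(2) mult.assoc)
    qed (use x b in \<open>simp_all add: order_periodic\<close>)
    moreover have "u * b = zpoly q'"
    proof (rule zpoly_cancel[OF _ p0])
      have "zpoly p * (u * b) = u * y"
        using zpoly_central[OF per(1), of p] by (simp add: b(2) mult.assoc[symmetric])
      then show "zpoly p * (u * b) = zpoly p * zpoly q'" by (simp add: uy q' zpoly_mult)
    qed (use b per in simp_all)
    ultimately have "intertwiner_pair u b q'"
      unfolding intertwiner_pair_def using b0 u order_const[OF b(1) b0] by blast
    with deg show ?thesis by blast
  qed
qed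

text \<open>In a pair with central factor of least degree this factor is \<open>1\<close>. The left inverse property follows
  since \<open>u\<close> has constant diagonal \<open>1\<close> and so is not a left zero divisor.\<close>

theorem graded_trivial_imp_inner:
  assumes m: "2 \<le> m" and triv: graded_trivial
  shows "\<exists>u\<in>glued_order. \<exists>y\<in>glued_order. (\<forall>i. entry u i 0 = 1) \<and> u * y = 1 \<and> y * u = 1 \<and>
    (\<forall>x\<in>glued_order. F x = y * x * u)"
proof -
  define D where "D n \<longleftrightarrow> (\<exists>u y q. intertwiner_pair u y q \<and> degree q = n)" for n
  have "\<exists>n. D n" using intertwiner_pair_exists[OF m triv] by (auto simp: D_def)
  then obtain n where "D n" and least: "\<And>k. k < n \<Longrightarrow> \<not> D k"
    using exists_least_iff[of D] by blast
  then obtain u y q where pair: "intertwiner_pair u y q" "degree q = n" by (auto simp: D_def)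
  have "degree q = 0"
    using intertwiner_pair_reduce[OF pair(1)] least pair(2) by (auto simp: D_def)
  have u: "u \<in> glued_order" "\<And>i. entry u i 0 = 1" "\<And>x. x \<in> glued_order \<Longrightarrow> x * u = u * F x"
    and y: "y \<in> glued_order" "\<And>i. entry y i 0 = 1" "\<And>x. x \<in> glued_order \<Longrightarrow> F x * y = y * x"
    and uy: "u * y = zpoly q"
    using pair by (auto simp: intertwiner_pair_def)
  have "coeff q 0 = entry (u * y) 0 0" by (simp add: uy entry_zpoly)
  then have "coeff q 0 = 1" by (simp add: entry_mult_0 u y)
  with \<open>degree q = 0\<close> have "q = 1" by (metis degree_0_id one_pCons)
  then have uy1: "u * y = 1" using uy by simp
  have "u * (y * u - 1) = 0" by (simp add: right_diff_distrib mult.assoc[symmetric] uy1)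
  then have "y * u - 1 = 0" using u(2) by (rule unipotent_cancel_left)
  then have yu1: "y * u = 1" by simp
  have "F x = y * x * u" if x: "x \<in> glued_order" for x
  proof -
    have "y * x * u = (y * u) * F x" using u(3)[OF x] by (simp add: mult.assoc)
    then show ?thesis by (simp add: yu1)
  qed
  with u y uy1 yu1 show ?thesis by blast
qed

text \<open>The associated graded maps of an automorphism and of its inverse are inverse to each other; dividing
  the automorphism by its associated graded map leaves one that is trivial on the associated graded
  algebra.\<close>

theorem inner_times_graded:
  assumes m: "2 \<le> m"
  shows "\<exists>u\<in>glued_order. \<exists>y\<in>glued_order. \<exists>H H'. u * y = 1 \<and> y * u = 1 \<and> order_auto m \<tau> H H' \<and>
    (\<forall>n. \<forall>a. H (diag_comp n a) = diag_comp n (H a)) \<and>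
    (\<forall>n. \<forall>a. H' (diag_comp n a) = diag_comp n (H' a)) \<and>
    (\<forall>x\<in>glued_order. F x = y * H x * u)"
proof -
  define H H' where "H = assoc_graded" and "H' = inv.assoc_graded"
  interpret H: order_hom m \<tau> H unfolding H_def by (rule order_hom_assoc_graded[OF m])
  interpret H': order_hom m \<tau> H' unfolding H'_def by (rule inv.order_hom_assoc_graded[OF m])
  have H'H: "H' (H a) = a" if a: "a \<in> glued_order" for a
  proof (rule utmat_eqI)
    fix i l
    have la: "low_zero l (F (diag_comp l a))" using a m by (intro hom_low_zero low_zero_diag_comp) auto
    have "diag_comp l (H a) = diag_comp l (F (diag_comp l a))"
      by (rule utmat_eqI) (simp add: H_def entry_assoc_graded)
    then have "entry (H' (H a)) i l = entry (G (diag_comp l (F (diag_comp l a)))) i l"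
      by (simp add: H'_def inv.entry_assoc_graded)
    also have "\<dots> = entry (G (F (diag_comp l a))) i l"
      using inv.hom_entry_low[OF m _ la] a by simp
    also have "\<dots> = entry a i l" using a by simp
    finally show "entry (H' (H a)) i l = entry a i l" .
  qed
  have HH': "H (H' a) = a" if a: "a \<in> glued_order" for a
  proof (rule utmat_eqI)
    fix i l
    have la: "low_zero l (G (diag_comp l a))" using a m by (intro inv.hom_low_zero low_zero_diag_comp) auto
    have "diag_comp l (H' a) = diag_comp l (G (diag_comp l a))"
      by (rule utmat_eqI) (simp add: H'_def inv.entry_assoc_graded)
    then have "entry (H (H' a)) i l = entry (F (diag_comp l (G (diag_comp l a)))) i l"
      by (simp add: H_def entry_assoc_graded)
    also have "\<dots> = entry (F (G (diag_comp l a))) i l"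
      using hom_entry_low[OF m _ la] a by simp
    also have "\<dots> = entry a i l" using a by simp
    finally show "entry (H (H' a)) i l = entry a i l" .
  qed
  have autoH: "order_auto m \<tau> H H'"
    by unfold_locales (simp_all add: HH' H'H)
  define \<phi> where "\<phi> = F \<circ> H'"
  interpret \<phi>: order_auto m \<tau> \<phi> "H \<circ> G"
    by unfold_locales (simp_all add: \<phi>_def hom_add hom_mult hom_scal H.hom_add H.hom_mult H.hom_scal
      H'.hom_add H'.hom_mult H'.hom_scal inv.hom_add inv.hom_mult inv.hom_scal HH' H'H)
  have gr: "H (diag_comp n a) = diag_comp n (H a)" "H' (diag_comp n a) = diag_comp n (H' a)" for n a
    by (simp_all add: H_def H'_def assoc_graded_diag_comp inv.assoc_graded_diag_comp)
  have "\<phi>.graded_trivial"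
  proof (rule \<phi>.graded_trivialI[OF m])
    fix n and a :: "'k utmat" assume a: "a \<in> glued_order" "diag_comp n a = a"
    have "diag_comp n (\<phi> a) = diag_comp n (F (H' a))" by (simp add: \<phi>_def)
    also have "\<dots> = diag_comp n (F (diag_comp n (H' a)))" using a gr(2)[of n a] by simp
    also have "\<dots> = diag_comp n (H (H' a))" by (rule utmat_eqI) (simp add: H_def entry_assoc_graded)
    finally show "diag_comp n (\<phi> a) = a" using a by (simp add: HH')
  qed
  from \<phi>.graded_trivial_imp_inner[OF m this] obtain u y where uy: "u \<in> glued_order" "y \<in> glued_order"
    "u * y = 1" "y * u = 1" "\<And>x. x \<in> glued_order \<Longrightarrow> \<phi> x = y * x * u" by blast
  have "F x = y * H x * u" if "x \<in> glued_order" for x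
    using uy(5)[OF H.closed[OF that]] that by (simp add: \<phi>_def H'H)
  with uy autoH gr show ?thesis by blast
qed

end

lemma (in order_hom) order_autoI:
  assumes G: "\<And>a. a \<in> glued_order \<Longrightarrow> G a \<in> glued_order"
    and GF: "\<And>a. a \<in> glued_order \<Longrightarrow> G (F a) = a"
    and FG: "\<And>a. a \<in> glued_order \<Longrightarrow> F (G a) = a"
  shows "order_auto m \<tau> F G"
proof
  fix a b :: "'k utmat" assume a: "a \<in> glued_order" and b: "b \<in> glued_order"
  have "F (G a + G b) = a + b" using G[OF a] G[OF b] by (simp add: hom_add FG a b)
  then show "G (a + b) = G a + G b" using GF[of "G a + G b"] G[OF a] G[OF b] by simp
  have "F (G a * G b) = a * b" using G[OF a] G[OF b] by (simp add: hom_mult FG a b)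
  then show "G (a * b) = G a * G b" using GF[of "G a * G b"] G[OF a] G[OF b] by simp
next
  fix a :: "'k utmat" and c assume a: "a \<in> glued_order"
  have "F (scal c (G a)) = scal c a" using G[OF a] by (simp add: hom_scal FG a)
  then show "G (scal c a) = scal c (G a)" using GF[of "scal c (G a)"] G[OF a] by simp
next
  show "G 1 = 1" using GF[of 1] by simp
qed (use assms in auto)

section \<open>The path algebra of a quiver\<close>

lemma path_target_conv: "path_target Q (u, w) = (if w = [] then u else head Q (last w))"
  by (simp add: path_target_def pre_digraph.awalk_verts_conv)

lemma path_target_append:
  "path_target Q (u, w @ w') = path_target Q (path_target Q (u, w), w')"
  by (simp add: path_target_conv)

lemma cas_path_target: "pre_digraph.cas Q u w v \<Longrightarrow> v = path_target Q (u, w)"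
  by (induction w arbitrary: u) (auto simp: pre_digraph.cas.simps path_target_conv)

lemma paths_iff: "(u, w) \<in> paths Q \<longleftrightarrow> pre_digraph.awalk Q u w (path_target Q (u, w))"
  unfolding paths_def pre_digraph.awalk_def using cas_path_target by fastforce

lemma (in wf_digraph) paths_append_iff:
  "(u, w @ w') \<in> paths G \<longleftrightarrow> (u, w) \<in> paths G \<and> (path_target G (u, w), w') \<in> paths G"
  unfolding paths_iff awalk_append_iff path_target_append
  by (auto simp: path_target_def)

text \<open>Each way of cutting a path into two pieces contributes once, so the product is a convolution over the
  cutting position. This turns associativity into a rearrangement of a double sum.\<close>

lemma lookup_path_mult:
  fixes f g :: "('v, 'a) path \<Rightarrow>\<^sub>0 'k::field"
  shows "Poly_Mapping.lookup (f \<otimes>\<^bsub>path_algebra Q\<^esub> g) (u, w)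
    = (\<Sum>k=0..length w. Poly_Mapping.lookup f (u, take k w)
        * Poly_Mapping.lookup g (path_target Q (u, take k w), drop k w))"
proof -
  let ?f = "Poly_Mapping.lookup f" and ?g = "Poly_Mapping.lookup g"
  have "Poly_Mapping.lookup (f \<otimes>\<^bsub>path_algebra Q\<^esub> g) (u, w)
    = (\<Sum>p\<in>Poly_Mapping.keys f. \<Sum>q\<in>Poly_Mapping.keys g.
        if path_target Q p = fst q \<and> (fst p, snd p @ snd q) = (u, w) then ?f p * ?g q else 0)"
    unfolding path_algebra_def by (auto simp: lookup_sum lookup_single when_def intro!: sum.cong)
  also have "\<dots> = (\<Sum>p\<in>Poly_Mapping.keys f. \<Sum>q\<in>Poly_Mapping.keys g.
      \<Sum>k=0..length w. if p = (u, take k w) \<and> q = (path_target Q (u, take k w), drop k w) then ?f p * ?g q else 0)"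
  proof (intro sum.cong refl)
    fix p q :: "('v, 'a) path"
    obtain a b where p: "p = (a, b)" by force
    obtain c d where q: "q = (c, d)" by force
    have "(\<Sum>k=0..length w. if p = (u, take k w) \<and> q = (path_target Q (u, take k w), drop k w) then ?f p * ?g q else 0)
      = (\<Sum>k=0..length w. if k = length b then
          (if path_target Q p = fst q \<and> (fst p, snd p @ snd q) = (u, w) then ?f p * ?g q else 0) else 0)"
      by (intro sum.cong refl) (auto simp: p q)
    also have "\<dots> = (if path_target Q p = fst q \<and> (fst p, snd p @ snd q) = (u, w) then ?f p * ?g q else 0)"
      by (auto simp: p q)
    finally show "(if path_target Q p = fst q \<and> (fst p, snd p @ snd q) = (u, w) then ?f p * ?g q else 0)
      = (\<Sum>k=0..length w. if p = (u, take k w) \<and> q = (path_target Q (u, take k w), drop k w) then ?f p * ?g q else 0)"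
      by simp
  qed
  also have "\<dots> = (\<Sum>p\<in>Poly_Mapping.keys f. \<Sum>k=0..length w. \<Sum>q\<in>Poly_Mapping.keys g.
      if p = (u, take k w) \<and> q = (path_target Q (u, take k w), drop k w) then ?f p * ?g q else 0)"
    by (intro sum.cong refl) (rule sum.swap)
  also have "\<dots> = (\<Sum>k=0..length w. \<Sum>p\<in>Poly_Mapping.keys f. \<Sum>q\<in>Poly_Mapping.keys g.
      if p = (u, take k w) \<and> q = (path_target Q (u, take k w), drop k w) then ?f p * ?g q else 0)"
    by (rule sum.swap)
  also have "\<dots> = (\<Sum>k=0..length w. ?f (u, take k w) * ?g (path_target Q (u, take k w), drop k w))"
  proof (intro sum.cong refl)
    fix k
    let ?q = "(path_target Q (u, take k w), drop k w)"
    have "(\<Sum>p\<in>Poly_Mapping.keys f. \<Sum>q\<in>Poly_Mapping.keys g.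
        if p = (u, take k w) \<and> q = ?q then ?f p * ?g q else 0)
      = (\<Sum>p\<in>Poly_Mapping.keys f. if p = (u, take k w) then
          \<Sum>q\<in>Poly_Mapping.keys g. (if q = ?q then ?f (u, take k w) * ?g ?q else 0) else 0)"
      by (intro sum.cong refl) (auto intro!: sum.cong sum.neutral)
    also have "\<dots> = ?f (u, take k w) * ?g ?q"
      by (auto simp: in_keys_iff)
    finally show "(\<Sum>p\<in>Poly_Mapping.keys f. \<Sum>q\<in>Poly_Mapping.keys g.
        if p = (u, take k w) \<and> q = ?q then ?f p * ?g q else 0) = ?f (u, take k w) * ?g ?q" .
  qed
  finally show ?thesis .
qed

lemma mem_path_algebra_iff:
  "f \<in> carrier (path_algebra Q) \<longleftrightarrow> (\<forall>p. p \<notin> paths Q \<longrightarrow> Poly_Mapping.lookup f p = 0)"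
  by (auto simp: path_algebra_def in_keys_iff)

lemma path_algebra_simps [simp]:
  "\<zero>\<^bsub>path_algebra Q\<^esub> = 0" "f \<oplus>\<^bsub>path_algebra Q\<^esub> g = f + g"
  by (simp_all add: path_algebra_def)

lemma lookup_path_smult: "Poly_Mapping.lookup (c \<odot>\<^bsub>path_algebra Q\<^esub> f) p = c * Poly_Mapping.lookup f p"
  by (simp add: path_algebra_def Poly_Mapping.map.rep_eq when_def)

lemma lookup_path_one:
  assumes "finite (verts Q)"
  shows "Poly_Mapping.lookup \<one>\<^bsub>path_algebra Q\<^esub> p = (if snd p = [] \<and> fst p \<in> verts Q then 1 else 0)"
proof -
  have "Poly_Mapping.lookup \<one>\<^bsub>path_algebra Q\<^esub> p = (\<Sum>v\<in>verts Q. if v = fst p then (if snd p = [] then 1 else 0) else 0)"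
    unfolding path_algebra_def
    by (cases p) (auto simp: lookup_sum lookup_single when_def intro!: sum.cong)
  then show ?thesis using assms by (auto split: if_splits)
qed

lemma (in fin_digraph) ring_path_algebra:
  "ring (path_algebra G :: ('k::field, ('a, 'b) path \<Rightarrow>\<^sub>0 'k) module)"
proof -
  let ?R = "path_algebra G :: ('k::field, ('a, 'b) path \<Rightarrow>\<^sub>0 'k) module"
  note L = lookup_path_mult[where Q=G and 'k='k]
  have ab: "abelian_group ?R"
  proof (rule abelian_groupI)
    fix x assume "x \<in> carrier ?R"
    then show "\<exists>y\<in>carrier ?R. y \<oplus>\<^bsub>?R\<^esub> x = \<zero>\<^bsub>?R\<^esub>"
      by (intro bexI[of _ "- x"]) (auto simp: mem_path_algebra_iff)
  qed (auto simp: mem_path_algebra_iff lookup_add algebra_simps)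
  have mon: "monoid ?R"
  proof (rule monoidI)
    fix x y z assume x: "x \<in> carrier ?R" and y: "y \<in> carrier ?R"
    show "x \<otimes>\<^bsub>?R\<^esub> y \<in> carrier ?R"
      unfolding mem_path_algebra_iff
    proof (intro allI impI)
      fix p :: "('a, 'b) path" assume p: "p \<notin> paths G"
      obtain u w where uw: "p = (u, w)" by force
      show "Poly_Mapping.lookup (x \<otimes>\<^bsub>?R\<^esub> y) p = 0"
        unfolding uw L
      proof (intro sum.neutral ballI)
        fix k
        have "(u, take k w) \<notin> paths G \<or> (path_target G (u, take k w), drop k w) \<notin> paths G"
          using p paths_append_iff[of u "take k w" "drop k w"] by (simp add: uw)
        then show "Poly_Mapping.lookup x (u, take k w)
            * Poly_Mapping.lookup y (path_target G (u, take k w), drop k w) = 0"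
          using x y by (auto simp: mem_path_algebra_iff)
      qed
    qed
    show "x \<otimes>\<^bsub>?R\<^esub> y \<otimes>\<^bsub>?R\<^esub> z = x \<otimes>\<^bsub>?R\<^esub> (y \<otimes>\<^bsub>?R\<^esub> z)"
    proof (rule poly_mapping_eqI)
      fix p :: "('a, 'b) path"
      obtain u w where uw: "p = (u, w)" by force
      define T where "T k = path_target G (u, take k w)" for k
      define F where "F i a b = Poly_Mapping.lookup x (u, take i w)
          * Poly_Mapping.lookup y (T i, take a (drop i w))
          * Poly_Mapping.lookup z (T (i + a), drop (i + a) w)" for i a b :: nat
      have T: "path_target G (T i, take a (drop i w)) = T (i + a)" for i a
        by (simp add: T_def path_target_append[symmetric] take_add)
      have "Poly_Mapping.lookup (x \<otimes>\<^bsub>?R\<^esub> y \<otimes>\<^bsub>?R\<^esub> z) p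
        = (\<Sum>j=0..length w. \<Sum>i=0..j. F i (j - i) (length w - j))"
        unfolding uw L sum_distrib_right
      proof (intro sum.cong)
        fix j i assume j: "j \<in> {0..length w}"
        assume i: "i \<in> {0..j}"
        then show "Poly_Mapping.lookup x (u, take i (take j w)) *
            Poly_Mapping.lookup y (path_target G (u, take i (take j w)), drop i (take j w)) *
            Poly_Mapping.lookup z (path_target G (u, take j w), drop j w) =
            F i (j - i) (length w - j)"
          by (simp add: F_def T_def drop_take min_def)
      qed auto
      also have "\<dots> = (\<Sum>j=0..length w. \<Sum>i=0..length w - j. F j i (length w - j - i))"
        by (rule fps_mult_assoc_lemma)
      also have "\<dots> = Poly_Mapping.lookup (x \<otimes>\<^bsub>?R\<^esub> (y \<otimes>\<^bsub>?R\<^esub> z)) p"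
        unfolding uw L sum_distrib_left T_def[symmetric] T
        by (intro sum.cong) (simp_all add: F_def mult.assoc add.commute)
      finally show "Poly_Mapping.lookup (x \<otimes>\<^bsub>?R\<^esub> y \<otimes>\<^bsub>?R\<^esub> z) p
        = Poly_Mapping.lookup (x \<otimes>\<^bsub>?R\<^esub> (y \<otimes>\<^bsub>?R\<^esub> z)) p" .
    qed
  next
    show "\<one>\<^bsub>?R\<^esub> \<in> carrier ?R"
      by (auto simp: mem_path_algebra_iff lookup_path_one paths_iff path_target_conv awalk_Nil_iff)
  next
    fix x assume x: "x \<in> carrier ?R"
    show "\<one>\<^bsub>?R\<^esub> \<otimes>\<^bsub>?R\<^esub> x = x"
    proof (rule poly_mapping_eqI)
      fix p :: "('a, 'b) path"
      obtain u w where uw: "p = (u, w)" by force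
      have "Poly_Mapping.lookup (\<one>\<^bsub>?R\<^esub> \<otimes>\<^bsub>?R\<^esub> x) p
        = (\<Sum>k=0..length w. if k = 0 then (if u \<in> verts G then Poly_Mapping.lookup x p else 0) else 0)"
        unfolding uw L by (intro sum.cong) (auto simp: lookup_path_one path_target_conv)
      moreover have "u \<in> verts G" if "p \<in> paths G" using that unfolding uw paths_iff by blast
      ultimately show "Poly_Mapping.lookup (\<one>\<^bsub>?R\<^esub> \<otimes>\<^bsub>?R\<^esub> x) p = Poly_Mapping.lookup x p"
        using x[unfolded mem_path_algebra_iff, rule_format, of p] by (auto split: if_splits)
    qed
    show "x \<otimes>\<^bsub>?R\<^esub> \<one>\<^bsub>?R\<^esub> = x"
    proof (rule poly_mapping_eqI)
      fix p :: "('a, 'b) path"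
      obtain u w where uw: "p = (u, w)" by force
      have "Poly_Mapping.lookup (x \<otimes>\<^bsub>?R\<^esub> \<one>\<^bsub>?R\<^esub>) p
        = (\<Sum>k=0..length w. if k = length w then (if path_target G p \<in> verts G then Poly_Mapping.lookup x p else 0) else 0)"
        unfolding uw L by (intro sum.cong) (auto simp: lookup_path_one)
      moreover have "path_target G p \<in> verts G" if "p \<in> paths G" using that unfolding uw paths_iff by blast
      ultimately show "Poly_Mapping.lookup (x \<otimes>\<^bsub>?R\<^esub> \<one>\<^bsub>?R\<^esub>) p = Poly_Mapping.lookup x p"
        using x[unfolded mem_path_algebra_iff, rule_format, of p] by (auto split: if_splits)
    qed
  qed
  show ?thesis
  proof (rule ringI[OF ab mon])
    fix x y z assume "x \<in> carrier ?R" "y \<in> carrier ?R" "z \<in> carrier ?R"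
    show "(x \<oplus>\<^bsub>?R\<^esub> y) \<otimes>\<^bsub>?R\<^esub> z = x \<otimes>\<^bsub>?R\<^esub> z \<oplus>\<^bsub>?R\<^esub> y \<otimes>\<^bsub>?R\<^esub> z"
      "z \<otimes>\<^bsub>?R\<^esub> (x \<oplus>\<^bsub>?R\<^esub> y) = z \<otimes>\<^bsub>?R\<^esub> x \<oplus>\<^bsub>?R\<^esub> z \<otimes>\<^bsub>?R\<^esub> y"
      by (auto intro!: poly_mapping_eqI simp: L lookup_add algebra_simps sum.distrib)
  qed
qed

lemma path_single_mult:
  "Poly_Mapping.single p c \<otimes>\<^bsub>path_algebra Q\<^esub> Poly_Mapping.single q d
    = (if path_target Q p = fst q then Poly_Mapping.single (fst p, snd p @ snd q) (c * d) else 0)"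
  by (cases "c = 0"; cases "d = 0") (auto simp: path_algebra_def)

section \<open>Quivers whose nonzero paths run along one cycle\<close>

text \<open>The sequence \<open>\<alpha>\<close> runs periodically through the arrows of the unique maximal path, and \<open>m\<close> is its
  length. Leaving the cycle gives zero, and staying on it is not a relation.\<close>

locale cyclic_presentation = fin_digraph Q
  for Q :: "('v, 'a) pre_digraph" +
  fixes I :: "(('v, 'a) path \<Rightarrow>\<^sub>0 'k::field) set"
    and R :: "('v, 'a) path set"
    and m :: nat
    and \<alpha> :: "nat \<Rightarrow> 'a"
  assumes m_pos: "0 < m"
    and \<alpha>_periodic: "\<alpha> (i + m) = \<alpha> i"
    and \<alpha>_inj: "\<alpha> i = \<alpha> j \<Longrightarrow> i mod m = j mod m"
    and arcs_range: "arcs Q = range \<alpha>"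
    and head_\<alpha>: "head Q (\<alpha> i) = tail Q (\<alpha> (Suc i))"
    and verts_range: "verts Q = range (\<lambda>i. tail Q (\<alpha> i))"
    and R_paths: "R \<subseteq> {p \<in> paths Q. path_length p = 2}"
    and I_def: "I = Idl\<^bsub>path_algebra Q\<^esub> (path_elt ` R)"
    and continuation_notin: "(tail Q (\<alpha> i), [\<alpha> i, \<alpha> (Suc i)]) \<notin> R"
    and other_continuation: "\<beta> \<in> arcs Q \<Longrightarrow> tail Q \<beta> = head Q (\<alpha> i) \<Longrightarrow> \<beta> \<noteq> \<alpha> (Suc i) \<Longrightarrow>
      path_elt (arrow2 Q (\<alpha> i) \<beta>) \<in> I"
begin

abbreviation "\<tau> \<equiv> \<lambda>i. tail Q (\<alpha> i)"

sublocale glued_cycle m \<tau>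
  by unfold_locales (simp_all add: m_pos \<alpha>_periodic)

abbreviation P :: "('k, ('v, 'a) path \<Rightarrow>\<^sub>0 'k) module" where "P \<equiv> path_algebra Q"

sublocale P: ring P by (rule ring_path_algebra)

text \<open>The path of length \<open>l\<close> along the cycle from position \<open>i\<close>.\<close>

definition cpath :: "nat \<Rightarrow> nat \<Rightarrow> ('v, 'a) path"
  where "cpath i l = (\<tau> i, map \<alpha> [i..<i + l])"

lemma path_target_cpath [simp]: "path_target Q (cpath i l) = \<tau> (i + l)"
  by (cases l) (auto simp: cpath_def path_target_conv head_\<alpha>)

lemma path_length_cpath [simp]: "path_length (cpath i l) = l"
  by (simp add: path_length_def cpath_def)

lemma arrow_in_paths: "\<beta> \<in> arcs Q \<Longrightarrow> (tail Q \<beta>, [\<beta>]) \<in> paths Q"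
  by (simp add: paths_iff path_target_conv awalk_def)

lemma vertex_in_paths: "v \<in> verts Q \<Longrightarrow> (v, []) \<in> paths Q"
  by (simp add: paths_iff path_target_conv awalk_Nil_iff)

lemma cpath_in_paths [simp]: "cpath i l \<in> paths Q"
proof (induction l)
  case 0
  then show ?case using vertex_in_paths[of "\<tau> i"] verts_range by (auto simp: cpath_def)
next
  case (Suc l)
  have "cpath i (Suc l) = (\<tau> i, snd (cpath i l) @ [\<alpha> (i + l)])" by (simp add: cpath_def)
  moreover have "cpath i l = (\<tau> i, snd (cpath i l))" by (simp add: cpath_def)
  ultimately show ?case
    using Suc arrow_in_paths[of "\<alpha> (i + l)"] arcs_range path_target_cpath[of i l]
    by (metis paths_append_iff rangeI)
qed

lemma \<alpha>_periodic': "\<alpha> (i + k * m) = \<alpha> i"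
proof (induction k)
  case (Suc k)
  have "\<alpha> (i + Suc k * m) = \<alpha> ((i + k * m) + m)" by (simp add: algebra_simps)
  then show ?case using Suc by (simp only: \<alpha>_periodic)
qed simp

lemma \<alpha>_cong: "i mod m = j mod m \<Longrightarrow> \<alpha> i = \<alpha> j"
  using \<alpha>_periodic' by (metis mod_div_mult_eq)

lemma cpath_cong: "i mod m = j mod m \<Longrightarrow> cpath i l = cpath j l"
proof -
  assume ij: "i mod m = j mod m"
  have "map \<alpha> [i..<i + l] = map \<alpha> [j..<j + l]"
  proof (rule nth_equalityI)
    fix k assume "k < length (map \<alpha> [i..<i + l])"
    moreover have "(i + k) mod m = (j + k) mod m" using ij by (metis mod_add_left_eq)
    ultimately show "map \<alpha> [i..<i + l] ! k = map \<alpha> [j..<j + l] ! k"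
      using \<alpha>_cong[of "i + k" "j + k"] by simp
  qed simp
  then show ?thesis using \<alpha>_cong[OF ij] by (simp add: cpath_def)
qed

text \<open>A nonstationary path along the cycle determines its position modulo \<open>m\<close> by its first arrow; a
  stationary one determines only the vertex, which is where gluing enters.\<close>

lemma entry_eq_of_cpath_eq:
  assumes "cpath i l = cpath j k" and a: "a \<in> glued_order"
  shows "l = k" "entry a i l = entry a j k"
proof -
  have "length (map \<alpha> [i..<i + l]) = length (map \<alpha> [j..<j + k])"
    using assms(1) by (metis cpath_def prod.inject)
  then show lk: "l = k" by simp
  show "entry a i l = entry a j k"
  proof (cases l)
    case 0
    then show ?thesis using order_glue[OF a, of i j] assms(1) lk by (simp add: cpath_def)
  next
    case (Suc l')
    then have "[i..<i + l] = i # [Suc i..<i + l]" "[j..<j + k] = j # [Suc j..<j + k]"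
      using lk by (simp_all add: upt_rec)
    then have "\<alpha> i = \<alpha> j" using assms(1) by (simp add: cpath_def)
    then show ?thesis unfolding lk by (intro periodic_cong[OF order_periodic[OF a]] \<alpha>_inj)
  qed
qed

text \<open>Coefficients of paths off the cycle are discarded; combinations of these paths form the ideal
  \<open>I\<close>.\<close>

definition matrix_of :: "(('v, 'a) path \<Rightarrow>\<^sub>0 'k) \<Rightarrow> 'k utmat"
  where "matrix_of f = UTMat (\<lambda>i l. Poly_Mapping.lookup f (cpath i l))"

lemma entry_matrix_of: "entry (matrix_of f) i l = Poly_Mapping.lookup f (cpath i l)"
  by (simp add: matrix_of_def)

lemma matrix_of_add: "matrix_of (f + g) = matrix_of f + matrix_of g"
  by (rule utmat_eqI) (simp add: entry_matrix_of lookup_add)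

lemma matrix_of_smult: "matrix_of (c \<odot>\<^bsub>P\<^esub> f) = scal c (matrix_of f)"
  by (rule utmat_eqI) (simp add: entry_matrix_of lookup_path_smult)

lemma matrix_of_one: "matrix_of \<one>\<^bsub>P\<^esub> = 1"
  by (rule utmat_eqI) (use verts_range in \<open>auto simp: entry_matrix_of lookup_path_one entry_1 cpath_def\<close>)

lemma matrix_of_mult: "matrix_of (f \<otimes>\<^bsub>P\<^esub> g) = matrix_of f * matrix_of g"
proof (rule utmat_eqI)
  fix i l
  have "entry (matrix_of (f \<otimes>\<^bsub>P\<^esub> g)) i l
      = (\<Sum>k=0..l. Poly_Mapping.lookup f (\<tau> i, take k (map \<alpha> [i..<i + l])) *
          Poly_Mapping.lookup g (path_target Q (\<tau> i, take k (map \<alpha> [i..<i + l])), drop k (map \<alpha> [i..<i + l])))"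
    unfolding entry_matrix_of cpath_def lookup_path_mult by simp
  also have "\<dots> = entry (matrix_of f * matrix_of g) i l"
    unfolding entry_mult entry_matrix_of
  proof (intro sum.cong refl)
    fix k assume "k \<in> {0..l}"
    then have "(\<tau> i, take k (map \<alpha> [i..<i + l])) = cpath i k"
      "drop k (map \<alpha> [i..<i + l]) = snd (cpath (i + k) (l - k))"
      by (simp_all add: cpath_def take_map drop_map take_upt drop_upt)
    moreover have "(\<tau> (i + k), snd (cpath (i + k) (l - k))) = cpath (i + k) (l - k)"
      by (simp add: cpath_def)
    ultimately show "Poly_Mapping.lookup f (\<tau> i, take k (map \<alpha> [i..<i + l])) *
          Poly_Mapping.lookup g (path_target Q (\<tau> i, take k (map \<alpha> [i..<i + l])), drop k (map \<alpha> [i..<i + l]))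
      = Poly_Mapping.lookup f (cpath i k) * Poly_Mapping.lookup g (cpath (i + k) (l - k))"
      by simp
  qed
  finally show "entry (matrix_of (f \<otimes>\<^bsub>P\<^esub> g)) i l = entry (matrix_of f * matrix_of g) i l" .
qed

lemma matrix_of_closed: "matrix_of f \<in> glued_order"
proof -
  define N where "N = Max (insert 0 (path_length ` Poly_Mapping.keys f))"
  have "Poly_Mapping.lookup f (cpath i l) = 0" if "l > N" for i l
  proof (rule ccontr)
    assume "Poly_Mapping.lookup f (cpath i l) \<noteq> 0"
    then have "cpath i l \<in> Poly_Mapping.keys f" by (simp add: in_keys_iff)
    then have "path_length (cpath i l) \<in> insert 0 (path_length ` Poly_Mapping.keys f)" by blast
    then have "l \<le> N" unfolding N_def path_length_cpath by (intro Max_ge) auto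
    with that show False by simp
  qed
  moreover have "cpath (i + m) l = cpath i l" for i l by (rule cpath_cong) simp
  ultimately have "periodic (matrix_of f)" unfolding periodic_def entry_matrix_of by metis
  moreover have "cpath i 0 = cpath j 0" if "\<tau> i = \<tau> j" for i j using that by (simp add: cpath_def)
  ultimately show ?thesis unfolding mem_order_iff entry_matrix_of by metis
qed

text \<open>The lift is supported on paths along the cycle, which keeps track of lengths when the grading is
  transferred.\<close>

lemma matrix_of_lift:
  assumes a: "a \<in> glued_order"
  obtains f where "matrix_of f = a"
    and "\<And>p. p \<in> Poly_Mapping.keys f \<Longrightarrow> \<exists>i l. p = cpath i l \<and> entry a i l \<noteq> 0"
proof -
  define g where "g p = (if \<exists>i l. p = cpath i l then
      entry a (fst (SOME (i, l). p = cpath i l)) (snd (SOME (i, l). p = cpath i l)) else 0)" for p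
  have g: "g (cpath i l) = entry a i l" for i l
  proof -
    obtain j k where jk: "(SOME (j, k). cpath i l = cpath j k) = (j, k)" by force
    have "case (SOME (j, k). cpath i l = cpath j k) of (j, k) \<Rightarrow> cpath i l = cpath j k"
      by (rule someI[of _ "(i, l)"]) simp
    then have "cpath i l = cpath j k" using jk by simp
    then have "entry a i l = entry a j k" using entry_eq_of_cpath_eq(2)[OF _ a] by blast
    moreover have "\<exists>j k. cpath i l = cpath j k" by blast
    ultimately show ?thesis unfolding g_def by (simp only: if_P jk fst_conv snd_conv)
  qed
  obtain N where N: "\<forall>i. \<forall>l>N. entry a i l = 0"
    using order_periodic[OF a] by (auto simp: periodic_def)
  have nz: "\<exists>i l. p = cpath i l \<and> entry a i l \<noteq> 0" if "g p \<noteq> 0" for p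
  proof -
    have "\<exists>i l. p = cpath i l"
    proof (rule ccontr)
      assume "\<not> ?thesis"
      then have "g p = 0" unfolding g_def by (rule if_not_P)
      with that show False by simp
    qed
    then obtain i l where p: "p = cpath i l" by blast
    then have "entry a i l \<noteq> 0" using that g by simp
    with p show ?thesis by blast
  qed
  have "{p. g p \<noteq> 0} \<subseteq> (\<lambda>(i, l). cpath i l) ` ({..<m} \<times> {..N})"
  proof
    fix p assume "p \<in> {p. g p \<noteq> 0}"
    then obtain i l where il: "p = cpath i l" "entry a i l \<noteq> 0" using nz by blast
    then have "l \<le> N" using N not_less by blast
    moreover have "p = cpath (i mod m) l" unfolding il(1) by (rule cpath_cong) simp
    ultimately show "p \<in> (\<lambda>(i, l). cpath i l) ` ({..<m} \<times> {..N})"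
      using m_pos by (intro image_eqI[of _ _ "(i mod m, l)"]) auto
  qed
  then have "finite {p. g p \<noteq> 0}" by (rule finite_subset) simp
  then have look: "Poly_Mapping.lookup (Abs_poly_mapping g) = g"
    by (simp add: Abs_poly_mapping_inverse)
  show thesis
  proof (rule that[of "Abs_poly_mapping g"])
    show "matrix_of (Abs_poly_mapping g) = a"
      by (rule utmat_eqI) (simp add: entry_matrix_of look g)
    show "\<And>p. p \<in> Poly_Mapping.keys (Abs_poly_mapping g) \<Longrightarrow> \<exists>i l. p = cpath i l \<and> entry a i l \<noteq> 0"
      by (rule nz) (simp add: in_keys_iff look)
  qed
qed

definition order_ring :: "('k, 'k utmat) module"
  where "order_ring = \<lparr>carrier = glued_order, monoid.mult = (*), monoid.one = 1,
    ring.zero = 0, ring.add = (+), module.smult = scal\<rparr>"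

lemma order_ring_simps [simp]:
  "carrier order_ring = glued_order" "x \<otimes>\<^bsub>order_ring\<^esub> y = x * y" "\<one>\<^bsub>order_ring\<^esub> = 1"
  "\<zero>\<^bsub>order_ring\<^esub> = 0" "x \<oplus>\<^bsub>order_ring\<^esub> y = x + y" "c \<odot>\<^bsub>order_ring\<^esub> x = scal c x"
  by (simp_all add: order_ring_def)

lemma ring_order_ring: "ring order_ring"
proof (intro ringI abelian_groupI monoidI)
  fix x assume "x \<in> carrier order_ring"
  then show "\<exists>y\<in>carrier order_ring. y \<oplus>\<^bsub>order_ring\<^esub> x = \<zero>\<^bsub>order_ring\<^esub>"
    by (intro bexI[of _ "- x"]) auto
qed (auto simp: algebra_simps)

lemma path_elt_in_carrier: "p \<in> paths Q \<Longrightarrow> Poly_Mapping.single p c \<in> carrier P"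
  by (auto simp: mem_path_algebra_iff lookup_single when_def)

lemma ideal_I: "ideal I P"
  unfolding I_def by (rule P.genideal_ideal) (use R_paths path_elt_in_carrier in auto)

sublocale I: ideal I P by (rule ideal_I)

lemma sum_single_lookup: "(\<Sum>p\<in>Poly_Mapping.keys f. Poly_Mapping.single p (Poly_Mapping.lookup f p)) = f"
proof (rule poly_mapping_eqI)
  fix k
  show "Poly_Mapping.lookup (\<Sum>p\<in>Poly_Mapping.keys f. Poly_Mapping.single p (Poly_Mapping.lookup f p)) k
    = Poly_Mapping.lookup f k"
    by (cases "k \<in> Poly_Mapping.keys f") (auto simp: lookup_sum lookup_single when_def in_keys_iff)
qed

text \<open>An ideal of the path algebra is closed under scalars because these act through multiples of
  stationary paths.\<close>

lemma single_in_I: "path_elt p \<in> I \<Longrightarrow> p \<in> paths Q \<Longrightarrow> Poly_Mapping.single p c \<in> I"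
proof -
  assume p: "path_elt p \<in> I" "p \<in> paths Q"
  obtain u w where uw: "p = (u, w)" by force
  have "u \<in> verts Q" using p(2) unfolding uw paths_iff by blast
  then have "Poly_Mapping.single (u, []) c \<otimes>\<^bsub>P\<^esub> path_elt p \<in> I"
    by (intro I.I_l_closed p path_elt_in_carrier vertex_in_paths)
  then show ?thesis by (simp add: path_single_mult path_target_conv uw)
qed

text \<open>Append arrows one by one: as long as the path runs along the cycle, the next arrow either continues
  it or forms a relation with the last one.\<close>

lemma non_cpath_in_I:
  assumes "(u, w) \<in> paths Q"
  shows "path_elt (u, w) \<in> I \<or> (\<exists>i. (u, w) = cpath i (length w))"
  using assms
proof (induction w rule: rev_induct)
  case Nil
  then have "u \<in> verts Q" unfolding paths_iff by blast
  then show ?case using verts_range by (auto simp: cpath_def)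
next
  case (snoc \<beta> w)
  have uw: "(u, w) \<in> paths Q" and t\<beta>: "(path_target Q (u, w), [\<beta>]) \<in> paths Q"
    using snoc.prems by (auto simp: paths_append_iff)
  from t\<beta> have \<beta>: "\<beta> \<in> arcs Q" "tail Q \<beta> = path_target Q (u, w)"
    by (auto simp: paths_iff awalk_def)
  from snoc.IH[OF uw] show ?case
  proof (elim disjE exE)
    assume "path_elt (u, w) \<in> I"
    then have "path_elt (u, w) \<otimes>\<^bsub>P\<^esub> path_elt (path_target Q (u, w), [\<beta>]) \<in> I"
      by (intro I.I_r_closed path_elt_in_carrier t\<beta>)
    then show ?thesis by (simp add: path_single_mult)
  next
    fix i assume i: "(u, w) = cpath i (length w)"
    then have u: "u = \<tau> i" by (simp add: cpath_def)
    show ?thesis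
    proof (cases w rule: rev_cases)
      case Nil
      obtain j where j: "\<beta> = \<alpha> j" using \<beta>(1) arcs_range by auto
      then have "(u, w @ [\<beta>]) = cpath j (length (w @ [\<beta>]))"
        using \<beta>(2) Nil by (simp add: cpath_def path_target_conv)
      then show ?thesis by blast
    next
      case (snoc w' \<gamma>)
      define l where "l = length w'"
      have w: "w = map \<alpha> [i..<i + Suc l]" using i snoc by (simp add: cpath_def l_def)
      then have w': "w = map \<alpha> [i..<i + l] @ [\<alpha> (i + l)]" by simp
      then have \<gamma>: "\<gamma> = \<alpha> (i + l)" "w' = map \<alpha> [i..<i + l]" using snoc by simp_all
      have h: "tail Q \<beta> = head Q (\<alpha> (i + l))" using \<beta>(2) snoc \<gamma> by (simp add: path_target_conv)
      show ?thesis
      proof (cases "\<beta> = \<alpha> (Suc (i + l))")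
        case True
        have "(u, w @ [\<beta>]) = cpath i (length (w @ [\<beta>]))"
          using True by (simp add: u w cpath_def)
        then show ?thesis by blast
      next
        case False
        then have "path_elt (arrow2 Q (\<alpha> (i + l)) \<beta>) \<in> I" using \<beta>(1) h by (intro other_continuation)
        then have "path_elt (cpath i l) \<otimes>\<^bsub>P\<^esub> path_elt (arrow2 Q (\<alpha> (i + l)) \<beta>) \<in> I"
          by (intro I.I_l_closed path_elt_in_carrier cpath_in_paths)
        then have "path_elt (u, w @ [\<beta>]) \<in> I"
          by (simp add: path_single_mult) (simp add: cpath_def u w')
        then show ?thesis ..
      qed
    qed
  qed
qed

lemma matrix_of_single_cpath: "entry (matrix_of (path_elt (cpath i l))) i l = 1"
  by (simp add: entry_matrix_of)

lemma matrix_of_ring_hom: "ring_hom_ring P order_ring matrix_of"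
proof (rule ring_hom_ringI)
  show "ring P" by (rule P.ring_axioms)
  show "ring order_ring" by (rule ring_order_ring)
qed (simp_all add: matrix_of_closed matrix_of_mult matrix_of_add matrix_of_one)

sublocale M: ring_hom_ring P order_ring matrix_of by (rule matrix_of_ring_hom)

text \<open>A relation is a path of length \<open>2\<close> off the cycle, so it is sent to \<open>0\<close>; conversely an element of the
  kernel is supported on paths off the cycle, which are multiples of relations.\<close>

lemma kernel_matrix_of: "a_kernel P order_ring matrix_of = I"
proof
  show "I \<subseteq> a_kernel P order_ring matrix_of"
    unfolding I_def
  proof (rule P.genideal_minimal[OF M.kernel_is_ideal], rule)
    fix x :: "('v, 'a) path \<Rightarrow>\<^sub>0 'k" assume "x \<in> path_elt ` R"
    then obtain p where p: "p \<in> R" "x = path_elt p" by auto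
    then have pp: "p \<in> paths Q" "path_length p = 2" using R_paths by auto
    have "cpath i l \<noteq> p" for i l
    proof
      assume eq: "cpath i l = p"
      then have "l = 2" using pp(2) path_length_cpath by metis
      then have "p = (\<tau> i, [\<alpha> i, \<alpha> (Suc i)])" using eq by (simp add: cpath_def numeral_2_eq_2)
      then show False using p(1) continuation_notin by simp
    qed
    then have "matrix_of x = 0"
      by (intro utmat_eqI) (auto simp: entry_matrix_of p lookup_single when_def)
    moreover have "x \<in> carrier P" unfolding p(2) by (rule path_elt_in_carrier[OF pp(1)])
    ultimately show "x \<in> a_kernel P order_ring matrix_of"
      unfolding a_kernel_def' order_ring_simps by blast
  qed
next
  show "a_kernel P order_ring matrix_of \<subseteq> I"
  proof
    fix f assume "f \<in> a_kernel P order_ring matrix_of"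
    then have f: "f \<in> carrier P" "matrix_of f = 0"
      unfolding a_kernel_def' order_ring_simps by blast+
    have "Poly_Mapping.single p (Poly_Mapping.lookup f p) \<in> I" if "p \<in> Poly_Mapping.keys f" for p
    proof -
      have p: "p \<in> paths Q" using that f(1) by (auto simp: path_algebra_def)
      have "p \<noteq> cpath i l" for i l
        using that f(2) by (metis entry_0 entry_matrix_of in_keys_iff)
      then have "path_elt p \<in> I" using non_cpath_in_I[of "fst p" "snd p"] p by auto
      then show ?thesis using p by (rule single_in_I)
    qed
    note single = this
    have sums: "S \<subseteq> Poly_Mapping.keys f \<Longrightarrow>
        (\<Sum>p\<in>S. Poly_Mapping.single p (Poly_Mapping.lookup f p)) \<in> I" for S
    proof (induction S rule: infinite_finite_induct)
      case (infinite S)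
      then show ?case using finite_subset[OF infinite.prems] by simp
    next
      case empty
      then show ?case using I.zero_closed by simp
    next
      case (insert p S)
      then show ?case using I.a_closed[OF single[of p]] by simp
    qed
    from sums[OF subset_refl] show "f \<in> I" by (simp only: sum_single_lookup)
  qed
qed

end

section \<open>The quotient algebra as a matrix algebra\<close>

context cyclic_presentation
begin

abbreviation A :: "('k, (('v, 'a) path \<Rightarrow>\<^sub>0 'k) set) module" where "A \<equiv> path_quot Q I"

lemma path_quot_simps:
  "carrier A = carrier (P Quot I)" "Z \<otimes>\<^bsub>A\<^esub> Y = Z \<otimes>\<^bsub>P Quot I\<^esub> Y" "\<one>\<^bsub>A\<^esub> = \<one>\<^bsub>P Quot I\<^esub>"
  "Z \<oplus>\<^bsub>A\<^esub> Y = Z \<oplus>\<^bsub>P Quot I\<^esub> Y" "\<zero>\<^bsub>A\<^esub> = \<zero>\<^bsub>P Quot I\<^esub>"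
  "c \<odot>\<^bsub>A\<^esub> Z = (\<Union>x\<in>Z. I +>\<^bsub>P\<^esub> (c \<odot>\<^bsub>P\<^esub> x))"
  by (simp_all add: path_quot_def ring.defs module.defs)

lemma ring_A: "ring A"
proof -
  interpret quot: ring "P Quot I" by (rule I.quotient_is_ring)
  have "abelian_group A"
  proof (rule abelian_groupI)
    fix Z assume "Z \<in> carrier A"
    then show "\<exists>Y\<in>carrier A. Y \<oplus>\<^bsub>A\<^esub> Z = \<zero>\<^bsub>A\<^esub>"
      by (intro bexI[of _ "\<ominus>\<^bsub>P Quot I\<^esub> Z"]) (simp_all add: path_quot_simps quot.l_neg)
  qed (simp_all add: path_quot_simps quot.a_ac)
  moreover have "monoid A"
    by (rule monoidI) (simp_all add: path_quot_simps quot.m_assoc)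
  ultimately show ?thesis
    by (rule ringI) (simp_all add: path_quot_simps quot.l_distr quot.r_distr)
qed

sublocale A: ring A by (rule ring_A)

text \<open>The isomorphism from the quotient algebra to the matrix algebra; its inverse is \<open>cls\<close> below.\<close>

definition mat :: "(('v, 'a) path \<Rightarrow>\<^sub>0 'k) set \<Rightarrow> 'k utmat"
  where "mat Z = the_elem (matrix_of ` Z)"

lemma mat_coset: "x \<in> carrier P \<Longrightarrow> mat (I +>\<^bsub>P\<^esub> x) = matrix_of x"
  using M.the_elem_simp[of x] by (simp add: mat_def kernel_matrix_of)

lemma cosetE:
  assumes "Z \<in> carrier A"
  obtains x where "x \<in> carrier P" "Z = I +>\<^bsub>P\<^esub> x"
  using M.quot_mem[of Z] assms by (auto simp: path_quot_simps kernel_matrix_of)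

lemma coset_in_carrier: "x \<in> carrier P \<Longrightarrow> I +>\<^bsub>P\<^esub> x \<in> carrier A"
  using I.rcos_ring_hom by (auto simp: path_quot_simps ring_hom_def)

lemma mat_ring_iso: "mat \<in> ring_iso A order_ring"
proof -
  have "a \<in> matrix_of ` carrier P" if a: "a \<in> glued_order" for a
  proof -
    obtain f where f: "matrix_of f = a"
      "\<And>p. p \<in> Poly_Mapping.keys f \<Longrightarrow> \<exists>i l. p = cpath i l \<and> entry a i l \<noteq> 0"
      using matrix_of_lift[OF a] by blast
    then have "f \<in> carrier P" by (auto simp: path_algebra_def) (metis cpath_in_paths)
    with f show ?thesis by blast
  qed
  then have "matrix_of ` carrier P = carrier order_ring" using matrix_of_closed by auto
  from M.FactRing_iso_set[OF this] have "mat \<in> ring_iso (P Quot I) order_ring"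
    by (simp add: mat_def[abs_def] kernel_matrix_of)
  then show ?thesis by (simp add: ring_iso_def ring_hom_def path_quot_simps)
qed

lemma mat_simps [simp]:
  "Z \<in> carrier A \<Longrightarrow> mat Z \<in> glued_order"
  "Z \<in> carrier A \<Longrightarrow> Y \<in> carrier A \<Longrightarrow> mat (Z \<otimes>\<^bsub>A\<^esub> Y) = mat Z * mat Y"
  "Z \<in> carrier A \<Longrightarrow> Y \<in> carrier A \<Longrightarrow> mat (Z \<oplus>\<^bsub>A\<^esub> Y) = mat Z + mat Y"
  "mat \<one>\<^bsub>A\<^esub> = 1"
  using mat_ring_iso by (auto simp: ring_iso_def ring_hom_def)

lemma mat_zero [simp]: "mat \<zero>\<^bsub>A\<^esub> = 0"
  using mat_simps(3)[of "\<zero>\<^bsub>A\<^esub>" "\<zero>\<^bsub>A\<^esub>"] by simp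

lemma mat_bij: "bij_betw mat (carrier A) glued_order"
  using mat_ring_iso by (simp add: ring_iso_def)

text \<open>Scalar multiplication on the quotient is a union over representatives; all of them have the same
  matrix, so the union has only one member.\<close>

lemma smult_coset:
  assumes x: "x \<in> carrier P"
  shows "c \<odot>\<^bsub>A\<^esub> (I +>\<^bsub>P\<^esub> x) = I +>\<^bsub>P\<^esub> (c \<odot>\<^bsub>P\<^esub> x)"
proof -
  have sc: "c \<odot>\<^bsub>P\<^esub> y \<in> carrier P" if "y \<in> carrier P" for y
    using that by (simp add: mem_path_algebra_iff lookup_path_smult)
  have "I +>\<^bsub>P\<^esub> (c \<odot>\<^bsub>P\<^esub> y) = I +>\<^bsub>P\<^esub> (c \<odot>\<^bsub>P\<^esub> x)" if y: "y \<in> I +>\<^bsub>P\<^esub> x" for y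
  proof -
    obtain i where i: "i \<in> I" "y = i \<oplus>\<^bsub>P\<^esub> x" using y by (auto simp: a_r_coset_def')
    then have yc: "y \<in> carrier P" using x by (metis I.a_Hcarr P.a_closed)
    have "matrix_of i = 0"
      using i(1) unfolding kernel_matrix_of[symmetric] a_kernel_def' order_ring_simps by blast
    then have "matrix_of y = matrix_of x" using i(2) by (simp add: matrix_of_add)
    then have "mat (I +>\<^bsub>P\<^esub> (c \<odot>\<^bsub>P\<^esub> y)) = mat (I +>\<^bsub>P\<^esub> (c \<odot>\<^bsub>P\<^esub> x))"
      by (simp add: mat_coset sc x yc matrix_of_smult)
    then show ?thesis
      using bij_betw_imp_inj_on[OF mat_bij] coset_in_carrier sc x yc by (meson inj_onD)
  qed
  moreover have "x \<in> I +>\<^bsub>P\<^esub> x" by (rule I.a_rcos_self[OF x])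
  ultimately show ?thesis unfolding path_quot_simps by blast
qed

lemma mat_smult: "Z \<in> carrier A \<Longrightarrow> c \<odot>\<^bsub>A\<^esub> Z \<in> carrier A \<and> mat (c \<odot>\<^bsub>A\<^esub> Z) = scal c (mat Z)"
proof -
  assume "Z \<in> carrier A"
  then obtain x where x: "x \<in> carrier P" "Z = I +>\<^bsub>P\<^esub> x" by (rule cosetE)
  moreover have "c \<odot>\<^bsub>P\<^esub> x \<in> carrier P"
    using x by (simp add: mem_path_algebra_iff lookup_path_smult)
  ultimately show ?thesis by (simp add: smult_coset mat_coset matrix_of_smult coset_in_carrier)
qed

definition cls :: "'k utmat \<Rightarrow> (('v, 'a) path \<Rightarrow>\<^sub>0 'k) set"
  where "cls = inv_into (carrier A) mat"

lemma cls_closed [simp]: "a \<in> glued_order \<Longrightarrow> cls a \<in> carrier A"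
  unfolding cls_def using mat_bij by (metis bij_betw_imp_surj_on inv_into_into)

lemma mat_cls [simp]: "a \<in> glued_order \<Longrightarrow> mat (cls a) = a"
  unfolding cls_def by (rule bij_betw_inv_into_right[OF mat_bij])

lemma cls_mat [simp]: "Z \<in> carrier A \<Longrightarrow> cls (mat Z) = Z"
  unfolding cls_def by (rule bij_betw_inv_into_left[OF mat_bij])

lemma mat_eqD: "mat Z = mat Y \<Longrightarrow> Z \<in> carrier A \<Longrightarrow> Y \<in> carrier A \<Longrightarrow> Z = Y"
  by (metis cls_mat)

lemma cls_mult: "a \<in> glued_order \<Longrightarrow> b \<in> glued_order \<Longrightarrow> cls (a * b) = cls a \<otimes>\<^bsub>A\<^esub> cls b"
  by (rule mat_eqD) auto

lemma cls_add: "a \<in> glued_order \<Longrightarrow> b \<in> glued_order \<Longrightarrow> cls (a + b) = cls a \<oplus>\<^bsub>A\<^esub> cls b"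
  by (rule mat_eqD) auto

lemma cls_1: "cls 1 = \<one>\<^bsub>A\<^esub>"
  by (rule mat_eqD) auto

lemma cls_scal: "a \<in> glued_order \<Longrightarrow> cls (scal c a) = c \<odot>\<^bsub>A\<^esub> cls a"
  by (rule mat_eqD) (auto simp: mat_smult)

lemma alg_auto_transport:
  assumes f: "f \<in> alg_auto A"
  shows "order_auto m \<tau> (\<lambda>a. mat (f (cls a))) (\<lambda>a. mat (inv_into (carrier A) f (cls a)))"
proof -
  have iso: "f \<in> ring_iso A A" and sm: "\<And>c Z. Z \<in> carrier A \<Longrightarrow> f (c \<odot>\<^bsub>A\<^esub> Z) = c \<odot>\<^bsub>A\<^esub> f Z"
    using f by (auto simp: alg_auto_def alg_iso_def)
  then have h: "f \<in> ring_hom A A" and b: "bij_betw f (carrier A) (carrier A)"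
    by (auto simp: ring_iso_def)
  have fc: "f Z \<in> carrier A" if "Z \<in> carrier A" for Z using h that by (rule ring_hom_closed)
  have ic: "inv_into (carrier A) f Z \<in> carrier A" if "Z \<in> carrier A" for Z
    using b that by (metis bij_betw_imp_surj_on inv_into_into)
  interpret F: order_hom m \<tau> "\<lambda>a. mat (f (cls a))"
    by unfold_locales
      (simp_all add: fc cls_add cls_mult cls_scal cls_1 ring_hom_add[OF h] ring_hom_mult[OF h]
        ring_hom_one[OF h] sm mat_smult)
  show ?thesis
    by (rule F.order_autoI)
      (simp_all add: fc ic bij_betw_inv_into_left[OF b] bij_betw_inv_into_right[OF b])
qed

lemma alg_auto_of_order_auto:
  assumes "order_auto m \<tau> F G"
  shows "(\<lambda>Z\<in>carrier A. cls (F (mat Z))) \<in> alg_auto A"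
proof -
  interpret order_auto m \<tau> F G by (rule assms)
  have "bij_betw (\<lambda>Z\<in>carrier A. cls (F (mat Z))) (carrier A) (carrier A)"
    by (rule bij_betw_byWitness[of _ "\<lambda>Z. cls (G (mat Z))"]) auto
  moreover have "(\<lambda>Z\<in>carrier A. cls (F (mat Z))) \<in> ring_hom A A"
    by (rule ring_hom_memI) (auto simp: hom_add hom_mult cls_add cls_mult cls_1)
  ultimately show ?thesis
    by (auto simp: alg_auto_def alg_iso_def ring_iso_def mat_smult hom_scal cls_scal)
qed

section \<open>The grading in terms of diagonals\<close>

text \<open>Membership in the span of a set of paths is a condition on the support of the matrix. For the
  converse below, the lift supported on the cycle is used as representative.\<close>

lemma path_spanD:
  assumes Z: "Z \<in> path_span Q I S" and S: "S \<subseteq> paths Q"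
  shows "Z \<in> carrier A" "\<And>i l. entry (mat Z) i l \<noteq> 0 \<Longrightarrow> cpath i l \<in> S"
proof -
  obtain x where x: "Z = I +>\<^bsub>P\<^esub> x" "Poly_Mapping.keys x \<subseteq> S" using Z by (auto simp: path_span_def)
  then have xc: "x \<in> carrier P" using S by (auto simp: path_algebra_def)
  show "Z \<in> carrier A" unfolding x by (rule coset_in_carrier[OF xc])
  fix i l assume "entry (mat Z) i l \<noteq> 0"
  then have "cpath i l \<in> Poly_Mapping.keys x"
    by (simp add: x mat_coset[OF xc] entry_matrix_of in_keys_iff)
  then show "cpath i l \<in> S" using x by blast
qed

lemma path_spanI:
  assumes Z: "Z \<in> carrier A" and S: "\<And>i l. entry (mat Z) i l \<noteq> 0 \<Longrightarrow> cpath i l \<in> S"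
  shows "Z \<in> path_span Q I S"
proof -
  obtain f where f: "matrix_of f = mat Z"
    "\<And>p. p \<in> Poly_Mapping.keys f \<Longrightarrow> \<exists>i l. p = cpath i l \<and> entry (mat Z) i l \<noteq> 0"
    using matrix_of_lift[of "mat Z"] Z by auto
  then have fc: "f \<in> carrier P" by (auto simp: path_algebra_def) (metis cpath_in_paths)
  have "Z = I +>\<^bsub>P\<^esub> f"
    by (rule mat_eqD) (simp_all add: mat_coset fc f Z coset_in_carrier)
  moreover have "Poly_Mapping.keys f \<subseteq> S" using f(2) S by blast
  ultimately show ?thesis by (auto simp: path_span_def)
qed

lemma cpath_in_basis: "cpath i l \<in> basis_paths Q I"
proof -
  have "path_elt (cpath i l) \<notin> I"
  proof
    assume "path_elt (cpath i l) \<in> I"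
    then have "matrix_of (path_elt (cpath i l)) = 0"
      unfolding kernel_matrix_of[symmetric] a_kernel_def' order_ring_simps by blast
    then show False using matrix_of_single_cpath[of i l] by simp
  qed
  then show ?thesis by (simp add: basis_paths_def)
qed

lemma degree_part_iff: "Z \<in> degree_part Q I n \<longleftrightarrow> Z \<in> carrier A \<and> diag_comp n (mat Z) = mat Z"
proof
  assume Z: "Z \<in> degree_part Q I n"
  have S: "{p \<in> basis_paths Q I. path_length p = n} \<subseteq> paths Q" by (auto simp: basis_paths_def)
  note sp = path_spanD[OF Z[unfolded degree_part_def] S]
  have "diag_comp n (mat Z) = mat Z"
  proof (rule utmat_eqI)
    fix i l
    show "entry (diag_comp n (mat Z)) i l = entry (mat Z) i l"
      using sp(2)[of i l] by auto
  qed
  with sp(1) show "Z \<in> carrier A \<and> diag_comp n (mat Z) = mat Z" by blast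
next
  assume Z: "Z \<in> carrier A \<and> diag_comp n (mat Z) = mat Z"
  show "Z \<in> degree_part Q I n"
    unfolding degree_part_def
  proof (rule path_spanI)
    fix i l assume nz: "entry (mat Z) i l \<noteq> 0"
    have "entry (diag_comp n (mat Z)) i l = entry (mat Z) i l" using Z by simp
    then have "l = n" using nz by (simp split: if_splits)
    then show "cpath i l \<in> {p \<in> basis_paths Q I. path_length p = n}" by (simp add: cpath_in_basis)
  qed (use Z in blast)
qed

lemma cls_in_positive_part:
  assumes "a \<in> glued_order" "\<And>i. entry a i 0 = 0"
  shows "cls a \<in> positive_part Q I"
  unfolding positive_part_def
proof (rule path_spanI)
  fix i l assume "entry (mat (cls a)) i l \<noteq> 0"
  then have "l \<noteq> 0" using assms by (cases l) auto
  then show "cpath i l \<in> {p \<in> basis_paths Q I. 0 < path_length p}" by (simp add: cpath_in_basis)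
qed (use assms in simp)

lemma mat_finsum:
  assumes "finite S" "\<And>n. n \<in> S \<Longrightarrow> g n \<in> carrier A"
  shows "mat (finsum A g S) = (\<Sum>n\<in>S. mat (g n))"
  using assms
proof (induction S rule: finite_induct)
  case (insert n S)
  then have "g \<in> S \<rightarrow> carrier A" by auto
  with insert show ?case by (simp add: A.finsum_insert A.finsum_closed)
qed simp

text \<open>Existence and uniqueness of the homogeneous decomposition, so that the description by a definite
  description in \<open>degree_component\<close> is meaningful.\<close>

lemma homogeneous_decomposition_iff:
  assumes z: "z \<in> carrier A"
  shows "homogeneous_decomposition Q I z g \<longleftrightarrow> g = (\<lambda>n. cls (diag_comp n (mat z)))"
proof
  assume hd: "homogeneous_decomposition Q I z g"
  define S where "S = {n. g n \<noteq> \<zero>\<^bsub>A\<^esub>}"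
  have g: "\<And>n. g n \<in> carrier A" "\<And>n. diag_comp n (mat (g n)) = mat (g n)"
    and fin: "finite S" and zs: "z = finsum A g S"
    using hd by (auto simp: homogeneous_decomposition_def degree_part_iff S_def)
  have mz: "mat z = (\<Sum>n\<in>S. mat (g n))" unfolding zs by (rule mat_finsum[OF fin g(1)])
  show "g = (\<lambda>n. cls (diag_comp n (mat z)))"
  proof
    fix k
    have "diag_comp k (mat z) = mat (g k)"
    proof (rule utmat_eqI)
      fix i l
      have "entry (mat (g n)) i k = (if n = k then entry (mat (g k)) i k else 0)" for n
      proof (cases "n = k")
        case False
        have "entry (mat (g n)) i k = entry (diag_comp n (mat (g n))) i k" by (simp only: g(2))
        with False show ?thesis by simp
      qed simp
      then have "entry (mat z) i k = (\<Sum>n\<in>S. if n = k then entry (mat (g k)) i k else 0)"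
        unfolding mz entry_sum by (intro sum.cong refl)
      also have "\<dots> = entry (mat (g k)) i k" using fin by (auto simp: S_def)
      finally have *: "entry (mat z) i k = entry (mat (g k)) i k" .
      show "entry (diag_comp k (mat z)) i l = entry (mat (g k)) i l"
        using * g(2)[of k] by (metis entry_diag_comp)
    qed
    then show "g k = cls (diag_comp k (mat z))" using g(1) by simp
  qed
next
  assume g: "g = (\<lambda>n. cls (diag_comp n (mat z)))"
  have go: "diag_comp n (mat z) \<in> glued_order" for n using z by simp
  obtain N where N: "\<forall>i. \<forall>l>N. entry (mat z) i l = 0"
    using order_periodic[of "mat z"] z by (auto simp: periodic_def)
  define S where "S = {n. g n \<noteq> \<zero>\<^bsub>A\<^esub>}"
  have Siff: "n \<in> S \<longleftrightarrow> diag_comp n (mat z) \<noteq> 0" for n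
  proof -
    have "diag_comp n (mat z) = 0" if "cls (diag_comp n (mat z)) = \<zero>\<^bsub>A\<^esub>"
      using mat_cls[OF go, of n] unfolding that by simp
    moreover have "cls 0 = \<zero>\<^bsub>A\<^esub>" by (rule mat_eqD) simp_all
    moreover have "n \<in> S \<longleftrightarrow> cls (diag_comp n (mat z)) \<noteq> \<zero>\<^bsub>A\<^esub>" by (simp only: S_def g mem_Collect_eq)
    ultimately show ?thesis by metis
  qed
  have "S \<subseteq> {..N}"
  proof
    fix n assume "n \<in> S"
    then have "diag_comp n (mat z) \<noteq> 0" by (simp add: Siff)
    then show "n \<in> {..N}" using N by (metis atMost_iff entry_0 entry_diag_comp not_less utmat_eqI)
  qed
  then have fin: "finite S" by (rule finite_subset) simp
  have "mat (finsum A g S) = (\<Sum>n\<in>S. diag_comp n (mat z))"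
    using mat_finsum[OF fin, of g] go by (simp add: g)
  also have "\<dots> = mat z"
  proof (rule utmat_eqI)
    fix i l
    have "entry (\<Sum>n\<in>S. diag_comp n (mat z)) i l = (if l \<in> S then entry (mat z) i l else 0)"
      using fin by (simp add: entry_sum)
    also have "\<dots> = entry (mat z) i l" using Siff[of l] by (metis entry_0 entry_diag_comp)
    finally show "entry (\<Sum>n\<in>S. diag_comp n (mat z)) i l = entry (mat z) i l" .
  qed
  finally have "z = finsum A g S"
    using z go by (intro mat_eqD[OF sym]) (auto simp: g intro!: A.finsum_closed)
  moreover have "g n \<in> degree_part Q I n" for n
    using go[of n] by (simp add: g degree_part_iff diag_comp_diag_comp)
  ultimately show "homogeneous_decomposition Q I z g"
    using fin unfolding homogeneous_decomposition_def S_def by blast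
qed

lemma degree_component_eq: "z \<in> carrier A \<Longrightarrow> degree_component Q I n z = cls (diag_comp n (mat z))"
proof -
  assume z: "z \<in> carrier A"
  have "(THE g. homogeneous_decomposition Q I z g) = (\<lambda>n. cls (diag_comp n (mat z)))"
    by (rule the_equality) (simp_all add: homogeneous_decomposition_iff[OF z])
  then show ?thesis by (simp add: degree_component_def)
qed

section \<open>Automorphisms of the quotient algebra\<close>

lemma cls_unit:
  assumes "u \<in> glued_order" "y \<in> glued_order" "u * y = 1" "y * u = 1"
  shows "cls u \<in> Units A" "inv\<^bsub>A\<^esub> cls u = cls y"
proof -
  have 1: "cls u \<otimes>\<^bsub>A\<^esub> cls y = \<one>\<^bsub>A\<^esub>" "cls y \<otimes>\<^bsub>A\<^esub> cls u = \<one>\<^bsub>A\<^esub>"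
    using assms by (simp_all add: cls_mult[symmetric] cls_1)
  with assms show "cls u \<in> Units A" by (auto simp: Units_def)
  show "inv\<^bsub>A\<^esub> cls u = cls y" using assms 1 by (intro A.inv_char) auto
qed

lemma conj_auto_cls:
  assumes "u \<in> glued_order" "y \<in> glued_order" "u * y = 1" "y * u = 1" "Z \<in> carrier A"
  shows "conj_auto A (cls u) Z = cls (y * mat Z * u)"
  using assms by (simp add: conj_auto_def cls_unit cls_mult)

text \<open>The conjugating matrix has constant diagonal \<open>1\<close>, so its class is \<open>1 + y\<close> with \<open>y\<close> of positive
  degree.\<close>

lemma Aut0_subset_Inn_star:
  assumes m: "2 \<le> m" shows "Aut0 Q I \<subseteq> Inn_star Q I"
proof
  fix f assume f: "f \<in> Aut0 Q I"
  then have fa: "f \<in> alg_auto A" by (simp add: Aut0_def)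
  define F where "F a = mat (f (cls a))" for a
  define G where "G a = mat (inv_into (carrier A) f (cls a))" for a
  interpret order_auto m \<tau> F G
    using alg_auto_transport[OF fa] by (simp add: F_def[abs_def] G_def[abs_def])
  have fc: "f Z \<in> carrier A" if "Z \<in> carrier A" for Z
    using fa that by (auto simp: alg_auto_def alg_iso_def ring_iso_def ring_hom_def)
  have graded_trivial
  proof (rule graded_trivialI[OF m])
    fix n and a :: "'k utmat" assume a: "a \<in> glued_order" "diag_comp n a = a"
    then have "cls a \<in> degree_part Q I n" by (simp add: degree_part_iff)
    then have "degree_component Q I n (f (cls a)) = cls a" using f by (simp add: Aut0_def)
    then have "cls (diag_comp n (F a)) = cls a" using a fc by (simp add: degree_component_eq F_def)
    then have "mat (cls (diag_comp n (F a))) = mat (cls a)" by simp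
    then show "diag_comp n (F a) = a" using a by simp
  qed
  from graded_trivial_imp_inner[OF m this] obtain u y where
    uy: "u \<in> glued_order" "y \<in> glued_order" "\<And>i. entry u i 0 = 1" "u * y = 1" "y * u = 1"
      "\<And>x. x \<in> glued_order \<Longrightarrow> F x = y * x * u"
    by blast
  have "f = conj_auto A (cls u)"
  proof
    fix Z
    show "f Z = conj_auto A (cls u) Z"
    proof (cases "Z \<in> carrier A")
      case True
      then have "f Z = cls (F (mat Z))" using fc by (simp add: F_def)
      then show ?thesis using True uy by (simp add: conj_auto_cls)
    next
      case False
      then show ?thesis using fa by (simp add: alg_auto_def conj_auto_def extensional_def)
    qed
  qed
  moreover have "cls u = \<one>\<^bsub>A\<^esub> \<oplus>\<^bsub>A\<^esub> cls (u - 1)"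
    using uy cls_add[of 1 "u - 1"] by (simp add: cls_1)
  moreover have "cls (u - 1) \<in> positive_part Q I"
    using uy by (intro cls_in_positive_part) (simp_all add: entry_1)
  moreover have "cls u \<in> Units A" using uy by (intro cls_unit)
  ultimately show "f \<in> Inn_star Q I" unfolding Inn_star_def by auto
qed

lemma automorphism_decomposition:
  assumes m: "2 \<le> m" and f: "f \<in> alg_auto A"
  shows "\<exists>\<phi>\<in>inner_auto A. \<exists>\<psi>\<in>graded_auto Q I. f = compose (carrier A) \<phi> \<psi>"
proof -
  define F where "F a = mat (f (cls a))" for a
  define G where "G a = mat (inv_into (carrier A) f (cls a))" for a
  interpret order_auto m \<tau> F G
    using alg_auto_transport[OF f] by (simp add: F_def[abs_def] G_def[abs_def])
  have fc: "f Z \<in> carrier A" if "Z \<in> carrier A" for Z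
    using f that by (auto simp: alg_auto_def alg_iso_def ring_iso_def ring_hom_def)
  obtain u y H H' where uy: "u \<in> glued_order" "y \<in> glued_order" "u * y = 1" "y * u = 1"
    and H: "order_auto m \<tau> H H'"
    and gr: "\<And>n a. H (diag_comp n a) = diag_comp n (H a)" "\<And>n a. H' (diag_comp n a) = diag_comp n (H' a)"
    and F: "\<And>x. x \<in> glued_order \<Longrightarrow> F x = y * H x * u"
    using inner_times_graded[OF m] by blast
  interpret H: order_auto m \<tau> H H' by (rule H)
  define \<psi> where "\<psi> = (\<lambda>Z\<in>carrier A. cls (H (mat Z)))"
  have "\<psi> \<in> alg_auto A" unfolding \<psi>_def by (rule alg_auto_of_order_auto[OF H])
  moreover have "\<psi> ` degree_part Q I n = degree_part Q I n" for n
  proof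
    show "\<psi> ` degree_part Q I n \<subseteq> degree_part Q I n"
    proof
      fix Y assume "Y \<in> \<psi> ` degree_part Q I n"
      then obtain Z where Z: "Z \<in> carrier A" "diag_comp n (mat Z) = mat Z" "Y = cls (H (mat Z))"
        by (auto simp: degree_part_iff \<psi>_def)
      then show "Y \<in> degree_part Q I n" by (simp add: degree_part_iff gr(1)[symmetric])
    qed
    show "degree_part Q I n \<subseteq> \<psi> ` degree_part Q I n"
    proof
      fix Y assume "Y \<in> degree_part Q I n"
      then have Y: "Y \<in> carrier A" "diag_comp n (mat Y) = mat Y" by (simp_all add: degree_part_iff)
      then have "cls (H' (mat Y)) \<in> degree_part Q I n"
        by (simp add: degree_part_iff gr(2)[symmetric])
      moreover have "Y = \<psi> (cls (H' (mat Y)))" using Y by (simp add: \<psi>_def)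
      ultimately show "Y \<in> \<psi> ` degree_part Q I n" by blast
    qed
  qed
  ultimately have "\<psi> \<in> graded_auto Q I" by (simp add: graded_auto_def)
  moreover have "conj_auto A (cls u) \<in> inner_auto A"
    unfolding inner_auto_def using cls_unit(1)[OF uy] by blast
  moreover have "f = compose (carrier A) (conj_auto A (cls u)) \<psi>"
  proof
    fix Z
    show "f Z = compose (carrier A) (conj_auto A (cls u)) \<psi> Z"
    proof (cases "Z \<in> carrier A")
      case True
      then have "f Z = cls (F (mat Z))" using fc by (simp add: F_def)
      then show ?thesis using True by (simp add: compose_def \<psi>_def conj_auto_cls[OF uy] F)
    next
      case False
      then show ?thesis using f by (simp add: alg_auto_def compose_def extensional_def)
    qed
  qed
  ultimately show ?thesis by blast
qed

text \<open>For \<open>m = 1\<close> periodicity makes all diagonals constant, so every matrix is a polynomial in \<open>z\<close>.\<close>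

lemma alg_isomorphic_poly:
  assumes "m = 1" shows "alg_isomorphic A (poly_algebra :: ('k, 'k poly) module)"
proof -
  define h where "h Z = entry_poly (mat Z) 0 0" for Z
  have h: "zpoly (h Z) = mat Z" if Z: "Z \<in> carrier A" for Z
  proof (rule utmat_eqI)
    fix i l
    have per: "periodic (mat Z)" using Z by (simp add: order_periodic)
    have m1: "m dvd l" "l div m = l" "m * l = l" "0 mod m = i mod m" using assms by simp_all
    show "entry (zpoly (h Z)) i l = entry (mat Z) i l"
      using periodic_cong[OF per m1(4), of l]
      by (simp only: entry_zpoly h_def coeff_entry_poly[OF per] m1 if_True add_0)
  qed
  have h_eqI: "h Z = q" if "Z \<in> carrier A" "mat Z = zpoly q" for Z q
    using h[OF that(1)] that(2) zpoly_inj by metis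
  have poly: "carrier (poly_algebra :: ('k, 'k poly) module) = UNIV"
    "p \<otimes>\<^bsub>poly_algebra\<^esub> q = p * q" "p \<oplus>\<^bsub>poly_algebra\<^esub> q = p + q" "\<one>\<^bsub>poly_algebra\<^esub> = (1 :: 'k poly)"
    "c \<odot>\<^bsub>poly_algebra\<^esub> p = Polynomial.smult c p" for p q :: "'k poly" and c
    by (simp_all add: poly_algebra_def)
  have "bij_betw h (carrier A) UNIV"
    by (rule bij_betw_byWitness[of _ "\<lambda>q. cls (zpoly q)"]) (auto simp: h intro: h_eqI)
  moreover have "h \<in> ring_hom A (poly_algebra :: ('k, 'k poly) module)"
    by (rule ring_hom_memI) (auto simp: poly h zpoly_mult zpoly_add intro!: h_eqI)
  moreover have "h (c \<odot>\<^bsub>A\<^esub> Z) = Polynomial.smult c (h Z)" if Z: "Z \<in> carrier A" for c Z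
  proof (rule h_eqI)
    have "mat (c \<odot>\<^bsub>A\<^esub> Z) = scal c (zpoly (h Z))" using mat_smult[OF Z] h[OF Z] by simp
    also have "\<dots> = zpoly (Polynomial.smult c (h Z))" by (rule utmat_eqI) (simp add: entry_zpoly)
    finally show "mat (c \<odot>\<^bsub>A\<^esub> Z) = zpoly (Polynomial.smult c (h Z))" .
  qed (use mat_smult[OF Z] in blast)
  ultimately have "h \<in> alg_iso A poly_algebra"
    by (auto simp: alg_iso_def ring_iso_def poly)
  then show ?thesis by (auto simp: alg_isomorphic_def)
qed

end

section \<open>The cycle of the unique maximal path\<close>

lemma (in wf_digraph) connected_vertex_incident:
  assumes "Digraph_Component.connected G" "\<beta> \<in> arcs G" "v \<in> verts G"
  shows "\<exists>\<gamma>\<in>arcs G. tail G \<gamma> = v \<or> head G \<gamma> = v"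
proof (cases "v = tail G \<beta>")
  case False
  have "tail G \<beta> \<in> verts G" using assms(2) by simp
  then have "v \<rightarrow>\<^sup>*\<^bsub>with_proj (mk_symmetric G)\<^esub> tail G \<beta>"
    using assms(1,3) by (auto simp: Digraph_Component.connected_def strongly_connected_def)
  then obtain w where "v \<rightarrow>\<^bsub>with_proj (mk_symmetric G)\<^esub> w"
    using False by (cases rule: pre_digraph.converse_reachable_cases) auto
  then show ?thesis by (auto simp: parcs_mk_symmetric)
qed (use assms in blast)

lemma list_split_two:
  assumes "Suc k < length xs"
  shows "xs = take k xs @ [xs ! k, xs ! Suc k] @ drop (Suc (Suc k)) xs"
  using assms by (metis Cons_nth_drop_Suc Suc_lessD append_Cons append_Nil append_take_drop_id)

text \<open>Let \<open>a\<close> be the periodic continuation of the arrow sequence of a generating cycle and \<open>m\<close> its least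
  period. Two successive arrows of \<open>a\<close> form no relation since powers of the cycle are nonzero, so an
  arrow that branches off forms one with its predecessor. Hence an arrow determines its successor in
  \<open>a\<close>, and a repetition within less than \<open>m\<close> steps would be a smaller period. Connectedness ensures
  that every vertex lies on the cycle.\<close>

lemma cyclic_presentation_exists:
  fixes Q :: "('v, 'a) pre_digraph" and I :: "(('v, 'a) path \<Rightarrow>\<^sub>0 'k::field) set"
  assumes gentle: "locally_gentle Q I" and uniq: "unique_infinite_maximal_path Q I"
  shows "\<exists>R m \<alpha>. cyclic_presentation Q I R m \<alpha>"
proof -
  let ?P = "path_algebra Q :: ('k, ('v, 'a) path \<Rightarrow>\<^sub>0 'k) module"
  have quiver: "fin_digraph Q" "Digraph_Component.connected Q" "arcs Q \<noteq> {}"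
    using gentle by (auto simp: locally_gentle_def quiver_def)
  interpret fin_digraph Q by (rule quiver(1))
  interpret P: ring ?P by (rule ring_path_algebra)
  obtain R where R: "R \<subseteq> {p \<in> paths Q. path_length p = 2}" and IR: "I = Idl\<^bsub>?P\<^esub> (path_elt ` R)"
    using gentle by (auto simp: locally_gentle_def)
  have elt: "path_elt p \<in> carrier ?P" if "p \<in> paths Q" for p
    using that by (auto simp: mem_path_algebra_iff lookup_single when_def)
  have RI: "path_elt ` R \<subseteq> carrier ?P" using R elt by auto
  interpret I: ideal I ?P unfolding IR by (rule P.genideal_ideal[OF RI])
  have exactly_one: "(path_elt (arrow2 Q \<alpha> \<beta>) \<in> I) \<noteq> (path_elt (arrow2 Q \<alpha> \<beta>') \<in> I)"
    if "\<alpha> \<in> arcs Q" "\<beta> \<in> arcs Q" "\<beta>' \<in> arcs Q" "head Q \<alpha> = tail Q \<beta>" "head Q \<alpha> = tail Q \<beta>'" "\<beta> \<noteq> \<beta>'"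
    for \<alpha> \<beta> \<beta>'
    using gentle that unfolding locally_gentle_def by blast
  obtain c where c: "infinite_path_generator Q I c"
    and cover: "\<And>\<beta>. \<beta> \<in> arcs Q \<Longrightarrow> \<exists>n. subpath (arrow Q \<beta>) (path_power c n)"
    using uniq unfolding unique_infinite_maximal_path_def by blast
  obtain v cs where vcs: "c = (v, cs)" by force
  have cyc: "(v, cs) \<in> paths Q" "cs \<noteq> []" "path_target Q (v, cs) = v"
    and pow: "\<And>n. path_elt (path_power c n) \<notin> I"
    using c by (auto simp: infinite_path_generator_def primitive_cycle_def cycle_path_def path_length_def vcs)
  define n where "n = length cs"
  have n: "0 < n" using cyc by (simp add: n_def)
  define a where "a i = cs ! (i mod n)" for i
  have a_set: "range a = set cs"
  proof
    show "range a \<subseteq> set cs" using n by (auto simp: a_def n_def intro!: nth_mem)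
    show "set cs \<subseteq> range a"
    proof
      fix x assume "x \<in> set cs"
      then obtain k where "k < n" "x = cs ! k" by (auto simp: in_set_conv_nth n_def)
      then have "x = a k" by (simp add: a_def)
      then show "x \<in> range a" by blast
    qed
  qed
  have cs_arcs: "set cs \<subseteq> arcs Q" using cyc(1) by (auto simp: paths_iff awalk_def)
  have arcs_a: "arcs Q = range a"
  proof
    show "range a \<subseteq> arcs Q" using cs_arcs a_set by simp
    show "arcs Q \<subseteq> range a"
    proof
      fix \<beta> assume "\<beta> \<in> arcs Q"
      then obtain N where "sublist [\<beta>] (concat (replicate N cs))"
        using cover by (fastforce simp: subpath_def path_power_def vcs)
      from set_mono_sublist[OF this] have "\<beta> \<in> set (concat (replicate N cs))" by simp
      then show "\<beta> \<in> range a" by (auto simp: a_set)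
    qed
  qed
  \<comment> \<open>Two rounds of the cycle contain every pair of successive arrows, also the pair that closes it.\<close>
  have double: "(v, cs @ cs) \<in> paths Q" using cyc by (simp add: paths_append_iff)
  have power2: "path_power c 2 = (v, cs @ cs)" by (simp add: path_power_def vcs numeral_2_eq_2)
  have step: "head Q (a i) = tail Q (a (Suc i)) \<and> path_elt (arrow2 Q (a i) (a (Suc i))) \<notin> I" for i
  proof -
    define k where "k = i mod n"
    have kn: "k < n" using n by (simp add: k_def)
    moreover have "length (cs @ cs) = n + n" by (simp add: n_def)
    ultimately have k: "Suc k < length (cs @ cs)" "k < n" using n by linarith+
    have ak: "(cs @ cs) ! k = a i" using k by (simp add: a_def k_def nth_append n_def)
    have "Suc i mod n = (if Suc k = n then 0 else Suc k)" by (simp add: k_def mod_Suc)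
    then have ask: "(cs @ cs) ! Suc k = a (Suc i)" using k by (auto simp: a_def nth_append n_def)
    define ws where "ws = take k (cs @ cs)"
    define zs where "zs = drop (Suc (Suc k)) (cs @ cs)"
    have split: "cs @ cs = ws @ [a i, a (Suc i)] @ zs"
      using list_split_two[OF k(1)] by (simp only: ak ask ws_def zs_def)
    have p: "(v, ws) \<in> paths Q" "(path_target Q (v, ws), [a i, a (Suc i)]) \<in> paths Q"
      "(head Q (a (Suc i)), zs) \<in> paths Q"
      using double unfolding split paths_append_iff by (auto simp: path_target_conv)
    from p(2) have t: "path_target Q (v, ws) = tail Q (a i)" "head Q (a i) = tail Q (a (Suc i))"
      by (auto simp: paths_iff awalk_Cons_iff awalk_Nil_iff)
    have "path_elt (arrow2 Q (a i) (a (Suc i))) \<notin> I"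
    proof
      assume "path_elt (arrow2 Q (a i) (a (Suc i))) \<in> I"
      then have "(path_elt (v, ws) \<otimes>\<^bsub>?P\<^esub> path_elt (arrow2 Q (a i) (a (Suc i))))
          \<otimes>\<^bsub>?P\<^esub> path_elt (head Q (a (Suc i)), zs) \<in> I"
        by (intro I.I_r_closed I.I_l_closed elt p)
      moreover have "path_target Q (v, ws @ [a i, a (Suc i)]) = head Q (a (Suc i))"
        by (simp add: path_target_conv)
      ultimately have "path_elt (path_power c 2) \<in> I"
        unfolding power2 split by (simp add: path_single_mult t(1))
      with pow show False by blast
    qed
    with t show ?thesis by blast
  qed
  define m where "m = (LEAST d. 0 < d \<and> (\<forall>i. a (i + d) = a i))"
  have "0 < n \<and> (\<forall>i. a (i + n) = a i)" using n by (simp add: a_def)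
  then have m: "0 < m" "\<And>i. a (i + m) = a i"
    unfolding m_def by (rule LeastI2_wellorder, blast)+
  have m_le: "m \<le> d" if "0 < d" "\<And>i. a (i + d) = a i" for d
    unfolding m_def by (rule Least_le) (use that in blast)
  have a_mult: "a (i + k * m) = a i" for i k
  proof (induction k)
    case (Suc k)
    then show ?case using m(2)[of "i + k * m"] by (simp add: ac_simps)
  qed simp
  have a_mod: "a (i mod m) = a i" for i
    using a_mult[of "i mod m" "i div m"] by (simp add: mod_div_mult_eq)
  have det: "a (Suc i) = a (Suc j)" if "a i = a j" for i j
  proof (rule ccontr)
    assume "a (Suc i) \<noteq> a (Suc j)"
    then have "(path_elt (arrow2 Q (a i) (a (Suc i))) \<in> I) \<noteq> (path_elt (arrow2 Q (a i) (a (Suc j))) \<in> I)"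
      using step[of i] step[of j] that arcs_a by (intro exactly_one) auto
    then show False using step[of i] step[of j] that by simp
  qed
  have det': "a (i + t) = a (j + t)" if "a i = a j" for i j t
    using that by (induction t) (auto intro: det)
  have no_repeat: False if ij: "i < j" "j < m" "a i = a j" for i j
  proof -
    have "a (k + (j - i)) = a k" for k
    proof -
      \<comment> \<open>Shift \<open>k\<close> by a multiple of \<open>m\<close> beyond \<open>i\<close>, from where the sequence repeats.\<close>
      have le: "i \<le> k + i * m" using m(1) by (metis Suc_leI le_add2 mult_le_mono2 nat_mult_1_right order_trans One_nat_def)
      have "a (i + (k + i * m - i)) = a (j + (k + i * m - i))" by (rule det'[OF ij(3)])
      moreover have "i + (k + i * m - i) = k + i * m" "j + (k + i * m - i) = (k + (j - i)) + i * m"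
        using le ij(1) by simp_all
      ultimately show ?thesis by (simp only: a_mult)
    qed
    then have "m \<le> j - i" using ij by (intro m_le) simp_all
    then show False using ij by simp
  qed
  have inj: "i mod m = j mod m" if "a i = a j" for i j
  proof -
    have "a (i mod m) = a (j mod m)" using that by (simp add: a_mod)
    moreover have "i mod m < m" "j mod m < m" using m(1) by simp_all
    ultimately show ?thesis using no_repeat by (metis linorder_neqE_nat)
  qed
  have verts: "verts Q = range (\<lambda>i. tail Q (a i))"
  proof
    show "range (\<lambda>i. tail Q (a i)) \<subseteq> verts Q" using arcs_a by auto
    show "verts Q \<subseteq> range (\<lambda>i. tail Q (a i))"
    proof
      fix w assume "w \<in> verts Q"
      moreover obtain \<beta> where "\<beta> \<in> arcs Q" using quiver(3) by blast
      ultimately obtain \<gamma> where "\<gamma> \<in> arcs Q" "tail Q \<gamma> = w \<or> head Q \<gamma> = w"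
        using connected_vertex_incident[OF quiver(2)] by blast
      moreover then obtain i where "\<gamma> = a i" using arcs_a by auto
      ultimately show "w \<in> range (\<lambda>i. tail Q (a i))" using step[of i] by auto
    qed
  qed
  have "cyclic_presentation Q I R m a"
  proof
    show "0 < m" "\<And>i. a (i + m) = a i" by (fact m)+
    show "\<And>i. (tail Q (a i), [a i, a (Suc i)]) \<notin> R"
    proof
      fix i assume "(tail Q (a i), [a i, a (Suc i)]) \<in> R"
      then have "path_elt (arrow2 Q (a i) (a (Suc i))) \<in> I"
        unfolding IR using P.genideal_self[OF RI] by blast
      then show False using step by blast
    qed
    show "path_elt (arrow2 Q (a i) \<beta>) \<in> I"
      if "\<beta> \<in> arcs Q" "tail Q \<beta> = head Q (a i)" "\<beta> \<noteq> a (Suc i)" for \<beta> i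
      using exactly_one[of "a i" \<beta> "a (Suc i)"] that step[of i] arcs_a by auto
    show "head Q (a i) = tail Q (a (Suc i))" for i using step by blast
  qed (fact inj arcs_a verts R IR)+
  then show ?thesis by blast
qed

theorem proposition1p4:
  fixes Q :: "('v, 'a) pre_digraph"
    and I :: "(('v, 'a) path \<Rightarrow>\<^sub>0 'k::field) set"
  assumes "locally_gentle Q I"
    and "unique_infinite_maximal_path Q I"
  shows "(alg_isomorphic (path_quot Q I) (poly_algebra :: ('k, 'k poly) module)
            \<or> Aut0 Q I \<subseteq> Inn_star Q I)
       \<and> (\<not> alg_isomorphic (path_quot Q I) (poly_algebra :: ('k, 'k poly) module) \<longrightarrow>
            (\<forall>f\<in>alg_auto (path_quot Q I).
               \<exists>\<phi>\<in>inner_auto (path_quot Q I). \<exists>\<psi>\<in>graded_auto Q I.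
                 f = compose (carrier (path_quot Q I)) \<phi> \<psi>))"
proof -
  obtain R m \<alpha> where "cyclic_presentation Q I R m \<alpha>"
    using cyclic_presentation_exists[OF assms] by blast
  then interpret cyclic_presentation Q I R m \<alpha> .
  show ?thesis
  proof (cases "m = 1")
    case True
    then show ?thesis using alg_isomorphic_poly by blast
  next
    case False
    then have "2 \<le> m" using m_pos by simp
    then show ?thesis using Aut0_subset_Inn_star automorphism_decomposition by blast
  qed
qed

end
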